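(* Let $\Omega=(0,1)^N$, let $m\in\mathbb{N}$, and let $H^m(\Omega)$ be equipped with the norm $$\|u\|_{H^m(\Omega)}:=\Big(\sum_{k\in\mathbb{Z}^N}(1+4\pi^2|k|^2)^m|u_k|^2\Big)^{1/2}$$ and corresponding inner product $\langle u,v\rangle_{H^m(\Omega)}:=\sum_{k\in\mathbb{Z}^N}(1+4\pi^2|k|^2)^mu_k\overline{v_k}$. Then for each $u\in L_2(\Omega)$ the element $E_m^*u$ is given by $$(E_m^*u)(x)=\sum_{k\in\mathbb{Z}^N}(1+4\pi^2|k|^2)^{-m}u_ke_k(x),$$ where $e_k(x)=\exp(2\pi i\,k\cdot x)$ and $u_k=\langle u,e_k\rangle_{L_2(\Omega)}$ are the Fourier coefficients of $u$.
   Context: $N\in\mathbb{N}$; $L_2(\Omega)$ is the complex Lebesgue space with $\langle u,v\rangle_{L_2(\Omega)}=\int_\Omega u\overline v\,dx$. The functions $e_k$, $k\in\mathbb{Z}^N$, form an orthonormal basis of $L_2(\Omega)$, and $u_k,v_k$ denote the Fourier coefficients of $u,v$, so $u=\sum_ku_ke_k$. $H^m(\Omega)$ is the Sobolev space of $u\in L_2(\Omega)$ with weak derivatives $D^\alpha u\in L_2(\Omega)$ for $0\le|\alpha|\le m$. $E_m:H^m(\Omega)\to L_2(\Omega)$, $E_mu:=u$, is the embedding operator, and its adjoint $E_m^*:L_2(\Omega)\to H^m(\Omega)$ is defined by $\langle E_m^*u,v\rangle_{H^m(\Omega)}=\langle u,v\rangle_{L_2(\Omega)}$ for all $u\in L_2(\Omega)$,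 $v\in H^m(\Omega)$ (with the inner product of the claim). *)

theory Defs
  imports "HOL-Analysis.Analysis"
begin

text \<open>
  Elements of the Lebesgue space are represented by functions on the whole space; their values
  outside the cube are irrelevant, and functions that agree almost everywhere on the cube
  represent the same element. The dimension is the cardinality of the index type.
\<close>

definition cube :: "(real ^ 'n) set" where
  "cube = {x. \<forall>i. 0 < x $ i \<and> x $ i < 1}"

definition L2 :: "(real ^ 'n \<Rightarrow> complex) set" where
  "L2 = {u. u \<in> borel_measurable (lebesgue_on cube) \<and>
            integrable (lebesgue_on cube) (\<lambda>x. (norm (u x))\<^sup>2)}"

definition L2_inner :: "(real ^ 'n \<Rightarrow> complex) \<Rightarrow> (real ^ 'n \<Rightarrow> complex) \<Rightarrow> complex" where
  "L2_inner u v = (LINT x|lebesgue_on cube. u x * cnj (v x))"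

definition L2_norm :: "(real ^ 'n \<Rightarrow> complex) \<Rightarrow> real" where
  "L2_norm u = sqrt (LINT x|lebesgue_on cube. (norm (u x))\<^sup>2)"

text \<open>Unordered convergence of a series of functions to \<open>s\<close> in the norm of \<open>L2\<close>.\<close>

definition L2_has_sum ::
    "('k \<Rightarrow> real ^ 'n \<Rightarrow> complex) \<Rightarrow> (real ^ 'n \<Rightarrow> complex) \<Rightarrow> bool" where
  "L2_has_sum f s \<longleftrightarrow> (\<forall>k. f k \<in> L2) \<and> s \<in> L2 \<and>
     ((\<lambda>F. L2_norm (\<lambda>x. s x - (\<Sum>k\<in>F. f k x))) \<longlongrightarrow> 0) (finite_subsets_at_top UNIV)"

definition freq :: "int ^ 'n \<Rightarrow> real ^ 'n" where
  "freq k = (\<chi> i. of_int (k $ i))"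

definition e :: "int ^ 'n \<Rightarrow> real ^ 'n \<Rightarrow> complex" where
  "e k x = exp (2 * of_real pi * \<i> * of_real (freq k \<bullet> x))"

definition fcoef :: "(real ^ 'n \<Rightarrow> complex) \<Rightarrow> int ^ 'n \<Rightarrow> complex" where
  "fcoef u k = L2_inner u (e k)"

definition partial :: "'n \<Rightarrow> (real ^ 'n \<Rightarrow> complex) \<Rightarrow> real ^ 'n \<Rightarrow> complex" where
  "partial i f x = frechet_derivative f (at x) (axis i 1)"

text \<open>
  All iterated partial derivatives are (totally) differentiable everywhere; in particular
  they are continuous, so this is the usual class of infinitely differentiable functions.
\<close>

definition smooth :: "(real ^ 'n \<Rightarrow> complex) \<Rightarrow> bool" where
  "smooth f \<longleftrightarrow> (\<forall>is x. foldr partial is f differentiable (at x))"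

text \<open>
  The derivative belonging to a multi-index \<open>\<alpha>\<close> takes \<open>\<alpha> i\<close> partial derivatives in direction
  \<open>i\<close>. The order of differentiation is chosen arbitrarily; it does not matter for the smooth
  functions to which this is applied.
\<close>

definition D :: "('n \<Rightarrow> nat) \<Rightarrow> (real ^ 'n \<Rightarrow> complex) \<Rightarrow> real ^ 'n \<Rightarrow> complex" where
  "D \<alpha> f = foldr partial (SOME is. \<forall>i. count_list is i = \<alpha> i) f"

definition order :: "('n::finite \<Rightarrow> nat) \<Rightarrow> nat" where
  "order \<alpha> = (\<Sum>i\<in>UNIV. \<alpha> i)"

definition test_functions :: "(real ^ 'n \<Rightarrow> complex) set" where
  "test_functions = {\<phi>. smooth \<phi> \<and> compact (closure {x. \<phi> x \<noteq> 0}) \<and>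
                        closure {x. \<phi> x \<noteq> 0} \<subseteq> cube}"

definition weak_derivative ::
    "('n \<Rightarrow> nat) \<Rightarrow> (real ^ 'n \<Rightarrow> complex) \<Rightarrow> (real ^ 'n \<Rightarrow> complex) \<Rightarrow> bool" where
  "weak_derivative \<alpha> u w \<longleftrightarrow>
     (\<forall>\<phi>\<in>test_functions.
        (LINT x|lebesgue_on cube. u x * D \<alpha> \<phi> x) =
        (- 1) ^ order \<alpha> * (LINT x|lebesgue_on cube. w x * \<phi> x))"

definition sobolev :: "nat \<Rightarrow> (real ^ 'n \<Rightarrow> complex) set" where
  "sobolev m = {u \<in> L2. \<forall>\<alpha>. order \<alpha> \<le> m \<longrightarrow> (\<exists>w\<in>L2. weak_derivative \<alpha> u w)}"

definition weight :: "nat \<Rightarrow> int ^ 'n \<Rightarrow> real" where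
  "weight m k = (1 + 4 * pi\<^sup>2 * (norm (freq k))\<^sup>2) ^ m"

text \<open>
  The norm is extended-valued: for \<open>m \<ge> 1\<close> the series diverges for those elements of
  \<open>sobolev m\<close> whose boundary values are not periodic (for example \<open>u x = x $ i\<close>).
\<close>

definition hm_norm :: "nat \<Rightarrow> (real ^ 'n \<Rightarrow> complex) \<Rightarrow> ereal" where
  "hm_norm m u =
     (if (\<lambda>k. weight m k * (norm (fcoef u k))\<^sup>2) summable_on UNIV
      then ereal (sqrt (\<Sum>\<^sub>\<infinity>k. weight m k * (norm (fcoef u k))\<^sup>2)) else \<infinity>)"

definition hm_inner_defined ::
    "nat \<Rightarrow> (real ^ 'n \<Rightarrow> complex) \<Rightarrow> (real ^ 'n \<Rightarrow> complex) \<Rightarrow> bool" where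
  "hm_inner_defined m u v \<longleftrightarrow>
     (\<lambda>k. of_real (weight m k) * fcoef u k * cnj (fcoef v k)) summable_on UNIV"

definition hm_inner ::
    "nat \<Rightarrow> (real ^ 'n \<Rightarrow> complex) \<Rightarrow> (real ^ 'n \<Rightarrow> complex) \<Rightarrow> complex" where
  "hm_inner m u v =
     (\<Sum>\<^sub>\<infinity>k. of_real (weight m k) * fcoef u k * cnj (fcoef v k))"

text \<open>
  \<open>A\<close> is the adjoint of the embedding of \<open>H\<close> into \<open>L2\<close>, where \<open>H\<close> carries the inner product
  \<open>hm_inner m\<close>. The defining identity includes the convergence of the series on its left-hand
  side, since an infinite sum that does not converge has the value 0 by convention. It determines
  \<open>A u\<close> up to equality almost everywhere on the cube.
\<close>

definition is_embedding_adjoint ::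
    "nat \<Rightarrow> (real ^ 'n \<Rightarrow> complex) set \<Rightarrow>
     ((real ^ 'n \<Rightarrow> complex) \<Rightarrow> (real ^ 'n \<Rightarrow> complex)) \<Rightarrow> bool" where
  "is_embedding_adjoint m H A \<longleftrightarrow>
     (\<forall>u\<in>L2. A u \<in> H \<and>
        (\<forall>v\<in>H. hm_inner_defined m (A u) v \<and> hm_inner m (A u) v = L2_inner u v))"

end

theory Submission
  imports Defs
begin

text \<open>
  In terms of Fourier coefficients the defining identity of the adjoint decouples. Testing it
  with \<open>v = e k\<close>, which lies in both candidate spaces, shows that the coefficient of \<open>A u\<close> at
  \<open>k\<close> is that of \<open>u\<close> divided by \<open>weight m k\<close>; by completeness of the trigonometric system
  (\<open>Fourier_series_L2\<close>) \<open>A u\<close> is the \<open>L2\<close> sum of its Fourier series, which is the claimed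
  formula. Conversely, the Riesz-Fischer theorem provides a function with these coefficients.
  It satisfies the identity by Parseval's theorem, its norm is finite, and it belongs to
  \<open>sobolev m\<close> because the termwise differentiated series up to order \<open>m\<close> still have
  square-summable coefficients (\<open>sobolevI\<close>).

  Orthonormality of the functions \<open>e k\<close> is computed with Fubini's theorem. Completeness follows
  from the Stone-Weierstrass theorem on the torus, followed by an approximation of indicators of
  open sets and a monotone class argument. The weak derivatives rest on integration by
  parts against test functions (\<open>integral_e_partial\<close>), which follows from the translation
  invariance of Lebesgue measure.
\<close>

section \<open>The space of square-integrable functions on the cube\<close>

lemma cube_eq_box: "cube = box (0 :: real ^ 'n) (\<chi> i. 1)"
  by (auto simp: cube_def mem_box_cart)

lemma cube_borel [measurable, simp]: "cube \<in> sets borel"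
  by (simp add: cube_eq_box)

lemma cube_lebesgue [measurable, simp]: "cube \<in> sets lebesgue"
  by (simp add: cube_eq_box)

lemma emeasure_cube: "emeasure lebesgue (cube :: (real ^ 'n) set) = 1"
proof -
  have "emeasure lborel (cube :: (real ^ 'n) set) = 1"
    unfolding cube_eq_box
    by (subst emeasure_lborel_box) (auto simp: Basis_vec_def inner_axis intro!: prod.neutral)
  then show ?thesis by simp
qed

lemma emeasure_space_cube: "emeasure (lebesgue_on cube) (cube :: (real ^ 'n) set) = 1"
  by (simp add: emeasure_restrict_space emeasure_cube)

lemma finite_measure_cube: "finite_measure (lebesgue_on (cube :: (real ^ 'n) set))"
  by (rule finite_measureI) (simp add: emeasure_space_cube)

lemma measurable_lebesgue_on_cube: "f \<in> borel_measurable borel \<Longrightarrow> f \<in> borel_measurable (lebesgue_on cube)"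
  by (intro measurable_restrict_space1 measurable_completion) simp

lemma L2_measurable [measurable_dest]: "u \<in> L2 \<Longrightarrow> u \<in> borel_measurable (lebesgue_on cube)"
  by (simp add: L2_def)

lemma L2_integrable_square: "u \<in> L2 \<Longrightarrow> integrable (lebesgue_on cube) (\<lambda>x. (norm (u x))\<^sup>2)"
  by (simp add: L2_def)

lemma L2_integrable_mult_norm:
  assumes "u \<in> L2" "v \<in> L2"
  shows "integrable (lebesgue_on cube) (\<lambda>x. norm (u x) * norm (v x))"
proof (rule Bochner_Integration.integrable_bound)
  show "integrable (lebesgue_on cube) (\<lambda>x. (norm (u x))\<^sup>2 + (norm (v x))\<^sup>2)"
    using assms by (intro Bochner_Integration.integrable_add L2_integrable_square)
  show "(\<lambda>x. norm (u x) * norm (v x)) \<in> borel_measurable (lebesgue_on cube)"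
    using assms[THEN L2_measurable] by measurable
  have "a * b \<le> a\<^sup>2 + b\<^sup>2" if "a \<ge> 0" "b \<ge> 0" for a b :: real
    using sum_squares_bound[of a b] mult_nonneg_nonneg[OF that] by linarith
  then show "AE x in lebesgue_on cube.
      norm (norm (u x) * norm (v x)) \<le> norm ((norm (u x))\<^sup>2 + (norm (v x))\<^sup>2)"
    by auto
qed

lemma L2_integrable_mult:
  assumes "u \<in> L2" "v \<in> L2"
  shows "integrable (lebesgue_on cube) (\<lambda>x. u x * v x)"
  by (rule Bochner_Integration.integrable_bound[OF L2_integrable_mult_norm[OF assms]])
     (use assms[THEN L2_measurable] in \<open>auto simp: norm_mult\<close>)

lemma L2_cnj: "u \<in> L2 \<Longrightarrow> (\<lambda>x. cnj (u x)) \<in> L2"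
  by (auto simp: L2_def intro!: measurable_compose[OF _ borel_measurable_continuous_onI[of cnj]]
      continuous_intros)

lemma L2_add:
  assumes "u \<in> L2" "v \<in> L2" shows "(\<lambda>x. u x + v x) \<in> L2"
proof -
  have [measurable]: "u \<in> borel_measurable (lebesgue_on cube)" "v \<in> borel_measurable (lebesgue_on cube)"
    using assms by (auto simp: L2_def)
  have "integrable (lebesgue_on cube) (\<lambda>x. (norm (u x + v x))\<^sup>2)"
  proof (rule Bochner_Integration.integrable_bound)
    show "integrable (lebesgue_on cube)
        (\<lambda>x. (norm (u x))\<^sup>2 + (norm (v x))\<^sup>2 + 2 * (norm (u x) * norm (v x)))"
      using assms by (intro Bochner_Integration.integrable_add L2_integrable_square
          integrable_mult_right L2_integrable_mult_norm) auto
    have "(norm (u x + v x))\<^sup>2 \<le> (norm (u x) + norm (v x))\<^sup>2" for x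
      by (intro power_mono norm_triangle_ineq) auto
    then show "AE x in lebesgue_on cube. norm ((norm (u x + v x))\<^sup>2)
        \<le> norm ((norm (u x))\<^sup>2 + (norm (v x))\<^sup>2 + 2 * (norm (u x) * norm (v x)))"
      by (auto simp: power2_sum mult.assoc)
  qed measurable
  then show ?thesis by (simp add: L2_def)
qed

lemma L2_cmult: "u \<in> L2 \<Longrightarrow> (\<lambda>x. c * u x) \<in> L2"
  by (auto simp: L2_def norm_mult power_mult_distrib)

lemma L2_diff:
  assumes "u \<in> L2" "v \<in> L2" shows "(\<lambda>x. u x - v x) \<in> L2"
  using L2_add[OF assms(1) L2_cmult[OF assms(2), of "-1"]] by simp

lemma L2_zero: "(\<lambda>x. 0) \<in> L2"
  by (simp add: L2_def)

lemma L2_sum: "(\<And>k. k \<in> F \<Longrightarrow> f k \<in> L2) \<Longrightarrow> (\<lambda>x. \<Sum>k\<in>F. f k x) \<in> L2"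
  by (induction F rule: infinite_finite_induct) (auto intro: L2_add L2_zero)

lemma L2_continuous:
  fixes f :: "real ^ 'n \<Rightarrow> complex"
  assumes "continuous_on UNIV f" shows "f \<in> L2"
proof -
  interpret finite_measure "lebesgue_on (cube :: (real ^ 'n) set)" by (rule finite_measure_cube)
  have m: "f \<in> borel_measurable (lebesgue_on cube)"
    using assms by (intro measurable_lebesgue_on_cube borel_measurable_continuous_onI)
  have "bounded (f ` cbox 0 (\<chi> i. 1))"
    by (intro compact_imp_bounded compact_continuous_image continuous_on_subset[OF assms]) auto
  then obtain B where B: "\<And>x. x \<in> cbox 0 (\<chi> i. 1) \<Longrightarrow> norm (f x) \<le> B"
    unfolding bounded_iff by blast
  have "integrable (lebesgue_on cube) (\<lambda>x. (norm (f x))\<^sup>2)"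
  proof (rule integrable_const_bound)
    have "norm (f x) \<le> B" if "x \<in> cube" for x
      using that box_subset_cbox by (intro B) (auto simp: cube_eq_box)
    then show "AE x in lebesgue_on cube. norm ((norm (f x))\<^sup>2) \<le> B\<^sup>2"
      by (auto intro!: power_mono)
  qed (use m in measurable)
  then show ?thesis using m by (simp add: L2_def)
qed

lemma L2_integrable: "u \<in> L2 \<Longrightarrow> integrable (lebesgue_on cube) u"
  using L2_integrable_mult[OF _ L2_continuous[of "\<lambda>_. 1"], of u] by simp

lemma L2_norm_square: "(L2_norm u)\<^sup>2 = (LINT x|lebesgue_on cube. (norm (u x))\<^sup>2)"
  by (simp add: L2_norm_def)

lemma L2_norm_nonneg: "L2_norm u \<ge> 0"
  by (simp add: L2_norm_def)

lemma L2_inner_self: "L2_inner u u = of_real ((L2_norm u)\<^sup>2)"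
  unfolding L2_inner_def L2_norm_square
  by (simp add: complex_norm_square[symmetric] del: of_real_power flip: integral_complex_of_real)

lemma L2_holder:
  assumes "u \<in> L2" "v \<in> L2"
  shows "(LINT x|lebesgue_on cube. norm (u x) * norm (v x)) \<le> L2_norm u * L2_norm v"
proof -
  let ?M = "lebesgue_on cube :: (real ^ 'a) measure"
  have [measurable]: "u \<in> borel_measurable ?M" "v \<in> borel_measurable ?M"
    using assms by (auto simp: L2_def)
  have "(\<integral>\<^sup>+x. ennreal (norm (u x)) * ennreal (norm (v x)) \<partial>?M)\<^sup>2
      \<le> (\<integral>\<^sup>+x. ennreal (norm (u x)) ^ 2 \<partial>?M) * (\<integral>\<^sup>+x. ennreal (norm (v x)) ^ 2 \<partial>?M)"
    by (rule Cauchy_Schwarz_nn_integral) measurable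
  also have "(\<integral>\<^sup>+x. ennreal (norm (u x)) * ennreal (norm (v x)) \<partial>?M)
      = ennreal (LINT x|?M. norm (u x) * norm (v x))"
    using L2_integrable_mult_norm[OF assms]
    by (subst nn_integral_eq_integral[symmetric]) (auto simp: ennreal_mult)
  also have "(\<integral>\<^sup>+x. ennreal (norm (u x)) ^ 2 \<partial>?M) = ennreal ((L2_norm u)\<^sup>2)"
    unfolding L2_norm_square using L2_integrable_square[OF assms(1)]
    by (subst nn_integral_eq_integral[symmetric]) (auto simp: ennreal_power)
  also have "(\<integral>\<^sup>+x. ennreal (norm (v x)) ^ 2 \<partial>?M) = ennreal ((L2_norm v)\<^sup>2)"
    unfolding L2_norm_square using L2_integrable_square[OF assms(2)]
    by (subst nn_integral_eq_integral[symmetric]) (auto simp: ennreal_power)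
  finally have "(LINT x|?M. norm (u x) * norm (v x))\<^sup>2 \<le> (L2_norm u * L2_norm v)\<^sup>2"
    by (simp add: ennreal_power power_mult_distrib flip: ennreal_mult)
  then show ?thesis
    by (rule power2_le_imp_le) (simp add: L2_norm_nonneg)
qed

lemma L2_Cauchy_Schwarz:
  assumes "u \<in> L2" "v \<in> L2"
  shows "norm (L2_inner u v) \<le> L2_norm u * L2_norm v"
proof -
  have "norm (L2_inner u v) \<le> (LINT x|lebesgue_on cube. norm (u x) * norm (v x))"
    unfolding L2_inner_def
    by (rule order_trans[OF integral_norm_bound]) (simp add: norm_mult)
  then show ?thesis using L2_holder[OF assms] by simp
qed

lemma L2_integral_norm_le:
  fixes u :: "real ^ 'n \<Rightarrow> complex"
  assumes "u \<in> L2"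
  shows "(LINT x|lebesgue_on cube. norm (u x)) \<le> L2_norm u"
proof -
  have "L2_norm (\<lambda>x :: real ^ 'n. 1) = 1"
    unfolding L2_norm_def by (simp add: measure_def emeasure_space_cube)
  then show ?thesis
    using L2_holder[OF assms L2_continuous[of "\<lambda>_. 1"]] by simp
qed

lemma L2_inner_add_left:
  assumes "u \<in> L2" "v \<in> L2" "w \<in> L2"
  shows "L2_inner (\<lambda>x. u x + v x) w = L2_inner u w + L2_inner v w"
  unfolding L2_inner_def
  by (simp add: distrib_right Bochner_Integration.integral_add[OF L2_integrable_mult L2_integrable_mult]
      assms L2_cnj)

lemma L2_inner_cmult_left: "L2_inner (\<lambda>x. c * u x) w = c * L2_inner u w"
  by (simp add: L2_inner_def mult.assoc)

lemma L2_inner_diff_left: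
  assumes "u \<in> L2" "v \<in> L2" "w \<in> L2"
  shows "L2_inner (\<lambda>x. u x - v x) w = L2_inner u w - L2_inner v w"
  using L2_inner_add_left[OF assms(1) L2_cmult[OF assms(2), of "-1"] assms(3)]
  by (simp add: L2_inner_cmult_left[of "-1", simplified])

lemma L2_inner_sum_left:
  assumes "\<And>k. k \<in> F \<Longrightarrow> f k \<in> L2" "w \<in> L2"
  shows "L2_inner (\<lambda>x. \<Sum>k\<in>F. f k x) w = (\<Sum>k\<in>F. L2_inner (f k) w)"
  using assms(1)
proof (induction F rule: infinite_finite_induct)
  case (insert k F)
  then show ?case using assms(2) by (simp add: L2_inner_add_left L2_sum)
qed (simp_all add: L2_inner_def)

lemma L2_inner_commute: "L2_inner u v = cnj (L2_inner v u)"
  using Bochner_Integration.integral_cnj[of "lebesgue_on cube" "\<lambda>x. v x * cnj (u x)"]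
  by (simp add: L2_inner_def mult.commute)

text \<open>
  By continuity of the inner product, a convergent series may be paired with a fixed function
  term by term. Parseval's identity and the weak derivatives of Fourier series are instances.
\<close>

lemma L2_has_sum_imp_inner_has_sum:
  assumes "L2_has_sum f s" "v \<in> L2"
  shows "((\<lambda>k. L2_inner (f k) v) has_sum L2_inner s v) UNIV"
proof -
  have f: "\<And>k. f k \<in> L2" and s: "s \<in> L2"
    and lim: "((\<lambda>F. L2_norm (\<lambda>x. s x - (\<Sum>k\<in>F. f k x))) \<longlongrightarrow> 0) (finite_subsets_at_top UNIV)"
    using assms(1) by (auto simp: L2_has_sum_def)
  have "((\<lambda>F. L2_inner s v - (\<Sum>k\<in>F. L2_inner (f k) v)) \<longlongrightarrow> 0) (finite_subsets_at_top UNIV)"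
  proof (rule Lim_null_comparison)
    have "norm (L2_inner s v - (\<Sum>k\<in>F. L2_inner (f k) v))
        \<le> L2_norm (\<lambda>x. s x - (\<Sum>k\<in>F. f k x)) * L2_norm v" for F
      using L2_Cauchy_Schwarz[OF L2_diff[OF s L2_sum[of F f, OF f]] assms(2)]
      by (simp add: L2_inner_diff_left L2_inner_sum_left L2_sum f s assms(2))
    then show "\<forall>\<^sub>F F in finite_subsets_at_top UNIV.
        norm (L2_inner s v - (\<Sum>k\<in>F. L2_inner (f k) v))
        \<le> L2_norm (\<lambda>x. s x - (\<Sum>k\<in>F. f k x)) * L2_norm v"
      by simp
    show "((\<lambda>F. L2_norm (\<lambda>x. s x - (\<Sum>k\<in>F. f k x)) * L2_norm v) \<longlongrightarrow> 0) (finite_subsets_at_top UNIV)"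
      using tendsto_mult_left_zero[OF lim] .
  qed
  then have "((\<lambda>F. L2_inner s v - (L2_inner s v - (\<Sum>k\<in>F. L2_inner (f k) v))) \<longlongrightarrow> L2_inner s v - 0)
      (finite_subsets_at_top UNIV)"
    by (intro tendsto_diff tendsto_const)
  then show ?thesis by (simp add: has_sum_def)
qed

section \<open>Orthonormality of the exponentials\<close>

lemma freq_add: "freq (j + k) = freq j + freq k"
  by (simp add: freq_def vec_eq_iff)

lemma freq_diff: "freq (j - k) = freq j - freq k"
  by (simp add: freq_def vec_eq_iff)

lemma e_eq_cis: "e k x = cis (2 * pi * (freq k \<bullet> x))"
  by (simp add: e_def cis_conv_exp mult_ac)

lemma norm_e [simp]: "norm (e k x) = 1"
  by (simp add: e_eq_cis)

lemma e_zero [simp]: "e 0 x = 1"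
  by (simp add: e_def freq_def inner_vec_def)

lemma e_mult: "e j x * e k x = e (j + k) x"
  by (simp add: e_eq_cis cis_mult freq_add inner_add_left distrib_left)

lemma e_mult_cnj: "e j x * cnj (e k x) = e (j - k) x"
  by (simp add: e_eq_cis cis_cnj cis_mult freq_diff inner_diff_left right_diff_distrib)

lemma continuous_on_e [continuous_intros]: "continuous_on A (e k)"
  unfolding e_def by (intro continuous_intros)

lemma e_in_L2 [simp]: "e k \<in> L2"
  by (rule L2_continuous[OF continuous_on_e])

lemma integral_cis_unit_interval:
  fixes n :: int
  assumes "n \<noteq> 0"
  shows "(LINT t|lborel. indicator {0<..<1} t *\<^sub>R cis (2 * pi * (of_int n * t))) = 0"
proof -
  let ?F = "\<lambda>t. exp (2 * pi * \<i> * of_int n * of_real t) / (2 * pi * \<i> * of_int n)"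
  have "(LBINT t=ereal 0..ereal 1. cis (2 * pi * (of_int n * t))) = ?F 1 - ?F 0"
  proof (rule interval_integral_FTC_finite)
    show "continuous_on {min 0 1..max 0 1} (\<lambda>t. cis (2 * pi * (of_int n * t)))"
      by (intro continuous_intros)
    have "((\<lambda>z. exp (2 * pi * \<i> * of_int n * z) / (2 * pi * \<i> * of_int n)) has_field_derivative
        exp (2 * pi * \<i> * of_int n * of_real t)) (at (of_real t))" for t :: real
      by (rule derivative_eq_intros refl | use assms in simp)+
    then have der: "(?F has_vector_derivative exp (2 * pi * \<i> * of_int n * of_real t)) (at t within A)"
      for t :: real and A
      by (rule has_vector_derivative_real_field)
    then show "(?F has_vector_derivative cis (2 * pi * (of_int n * t))) (at t within {min 0 1..max 0 1})"
      for t
    proof -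
      have "cis (2 * pi * (of_int n * t)) = exp (2 * pi * \<i> * of_int n * of_real t)"
        unfolding cis_conv_exp by (simp add: mult_ac)
      then show ?thesis using der by simp
    qed
  qed
  also have "?F 1 - ?F 0 = 0"
    using exp_integer_2pi[of "of_int n"] by (simp add: mult_ac)
  finally show ?thesis
    by (simp add: interval_lebesgue_integral_def einterval_def set_lebesgue_integral_def
        greaterThanLessThan_def greaterThan_def lessThan_def Int_def zero_ereal_def one_ereal_def)
qed

lemma integral_e: "(LINT x|lebesgue_on cube. e k x) = (if k = 0 then 1 else 0)"
  for k :: "int ^ 'n"
proof (cases "k = 0")
  case True
  then show ?thesis by (simp add: measure_def emeasure_space_cube)
next
  case False
  then obtain i where i: "k $ i \<noteq> 0" by (auto simp: vec_eq_iff)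
  define g :: "real ^ 'n \<Rightarrow> real \<Rightarrow> complex"
    where "g b t = indicator {0<..<1} t *\<^sub>R cis (2 * pi * ((freq k \<bullet> b) * t))" for b t
  \<comment> \<open>the integrand is a product of functions of the single coordinates\<close>
  have prod_g: "indicator cube x *\<^sub>R e k x = (\<Prod>b\<in>Basis. g b (x \<bullet> b))" for x
  proof -
    have "indicator cube x = (\<Prod>b\<in>Basis. indicator {0<..<1} (x \<bullet> b) :: real)"
      by (auto simp: cube_def indicator_def Basis_vec_def inner_axis intro!: prod.neutral)
    moreover have "e k x = (\<Prod>b\<in>Basis. cis (2 * pi * ((freq k \<bullet> b) * (x \<bullet> b))))"
      unfolding e_def cis_conv_exp
      by (subst euclidean_inner) (simp add: exp_sum[symmetric] sum_distrib_left sum_distrib_right mult_ac)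
    ultimately show ?thesis
      by (simp add: g_def scaleR_conv_of_real prod.distrib)
  qed
  have meas_g [measurable]: "g b \<in> borel_measurable borel" for b
    unfolding g_def
    by (intro borel_measurable_scaleR borel_measurable_indicator borel_measurable_continuous_onI continuous_intros) simp
  have int_g: "integrable lborel (g b)" for b
    unfolding g_def
    by (rule integrableI_bounded_set_indicator[where B = 1])
       (auto intro!: borel_measurable_continuous_onI continuous_intros)
  have "(LINT x|lebesgue_on cube. e k x) = (LINT x|lebesgue. indicator cube x *\<^sub>R e k x)"
    by (subst integral_restrict_space) auto
  also have "\<dots> = (LINT x|lborel. (\<Prod>b\<in>Basis. g b (x \<bullet> b)))"
    unfolding prod_g by (rule integral_completion) measurable
  also have "\<dots> = (LINT y|(\<Pi>\<^sub>M b\<in>(Basis :: (real ^ 'n) set). lborel). (\<Prod>b\<in>Basis. g b (y b)))"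
    by (subst lborel_eq, subst integral_distr) (auto intro!: Bochner_Integration.integral_cong prod.cong)
  also have "\<dots> = (\<Prod>b\<in>Basis. LINT t|lborel. g b t)"
  proof -
    interpret product_sigma_finite "\<lambda>_ :: real ^ 'n. lborel :: real measure" by standard
    show ?thesis by (rule product_integral_prod) (auto intro: int_g)
  qed
  also have "\<dots> = 0"
  proof (rule prod_zero)
    have "(LINT t|lborel. g (axis i 1) t) = 0"
      using integral_cis_unit_interval[OF i] by (simp add: g_def inner_axis freq_def)
    then show "\<exists>b\<in>Basis. (LINT t|lborel. g b t) = 0"
      by (intro bexI[of _ "axis i 1"]) auto
  qed simp
  finally show ?thesis using False by simp
qed

lemma e_orthonormal: "L2_inner (e j) (e k) = (if j = k then 1 else 0)"
  by (simp add: L2_inner_def e_mult_cnj integral_e)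

lemma fcoef_e: "fcoef (e j) k = (if j = k then 1 else 0)"
  by (simp add: fcoef_def e_orthonormal)

lemma fcoef_trig_sum:
  "finite F \<Longrightarrow> fcoef (\<lambda>x. \<Sum>j\<in>F. c j * e j x) k = (if k \<in> F then c k else 0)"
  by (simp add: fcoef_def L2_inner_sum_left L2_cmult L2_inner_cmult_left e_orthonormal if_distrib cong: if_cong)

lemma trig_sum_in_L2: "(\<lambda>x. \<Sum>j\<in>F. c j * e j x) \<in> L2"
  by (intro L2_sum L2_cmult) simp

lemma L2_inner_trig_sum_right:
  assumes "u \<in> L2"
  shows "L2_inner u (\<lambda>x. \<Sum>k\<in>F. c k * e k x) = (\<Sum>k\<in>F. cnj (c k) * fcoef u k)"
  using assms
  by (subst L2_inner_commute)
     (simp add: L2_inner_sum_left L2_cmult L2_inner_cmult_left fcoef_def, subst L2_inner_commute, simp)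

lemma L2_norm_trig_sum:
  assumes "finite F"
  shows "(L2_norm (\<lambda>x. \<Sum>k\<in>F. c k * e k x))\<^sup>2 = (\<Sum>k\<in>F. (norm (c k))\<^sup>2)"
proof -
  have "complex_of_real ((L2_norm (\<lambda>x. \<Sum>k\<in>F. c k * e k x))\<^sup>2) = (\<Sum>k\<in>F. cnj (c k) * c k)"
    unfolding L2_inner_self[symmetric]
    by (subst L2_inner_trig_sum_right[OF trig_sum_in_L2]) (simp add: fcoef_trig_sum assms)
  also have "\<dots> = complex_of_real (\<Sum>k\<in>F. (norm (c k))\<^sup>2)"
    unfolding of_real_sum complex_norm_square by (intro sum.cong mult.commute refl)
  finally show ?thesis by (simp only: of_real_eq_iff)
qed

lemma Bessel_inequality:
  assumes "u \<in> L2" "finite F"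
  shows "(\<Sum>k\<in>F. (norm (fcoef u k))\<^sup>2) \<le> (L2_norm u)\<^sup>2"
proof -
  let ?S = "\<lambda>x. \<Sum>k\<in>F. fcoef u k * e k x"
  let ?a = "\<Sum>k\<in>F. (norm (fcoef u k))\<^sup>2"
  have "complex_of_real ?a = L2_inner u ?S"
    unfolding L2_inner_trig_sum_right[OF assms(1)] of_real_sum complex_norm_square
    by (intro sum.cong mult.commute refl)
  then have "norm (L2_inner u ?S) = \<bar>?a\<bar>"
    using norm_of_real[of ?a, where 'a = complex] by simp
  then have "?a \<le> norm (L2_inner u ?S)"
    by simp
  also have "\<dots> \<le> L2_norm u * L2_norm ?S"
    by (rule L2_Cauchy_Schwarz[OF assms(1) trig_sum_in_L2])
  also have "L2_norm ?S = sqrt ?a"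
    using real_sqrt_unique[OF L2_norm_trig_sum[OF assms(2), of "fcoef u"] L2_norm_nonneg] by simp
  finally have "sqrt ?a * sqrt ?a \<le> L2_norm u * sqrt ?a"
    by (simp add: sum_nonneg)
  then have "sqrt ?a \<le> L2_norm u"
    using L2_norm_nonneg[of u] sum_nonneg[of F "\<lambda>k. (norm (fcoef u k))\<^sup>2"]
    by (cases "?a = 0") (simp, rule mult_right_le_imp_le[of _ "sqrt ?a"], auto)
  then have "(sqrt ?a)\<^sup>2 \<le> (L2_norm u)\<^sup>2"
    by (intro power_mono) (auto simp: sum_nonneg)
  then show ?thesis by (simp add: sum_nonneg)
qed

lemma fcoef_square_summable:
  assumes "u \<in> L2"
  shows "(\<lambda>k. (norm (fcoef u k))\<^sup>2) summable_on UNIV"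
  by (rule nonneg_bdd_above_summable_on) (auto intro!: bdd_aboveI[of _ "(L2_norm u)\<^sup>2"] Bessel_inequality assms)

section \<open>The Riesz-Fischer theorem\<close>

text \<open>
  Along finite sets \<open>F n\<close> that exhaust the index set and whose tails decrease geometrically,
  the partial sums converge almost everywhere, since the integrals of their increments are
  summable. Fatou's lemma bounds the distance of the pointwise limit from every finite partial
  sum by the corresponding tail, which gives unordered convergence in norm.
\<close>

theorem Riesz_Fischer:
  fixes c :: "int ^ 'n \<Rightarrow> complex"
  assumes summable: "(\<lambda>k. (norm (c k))\<^sup>2) summable_on UNIV"
  obtains U where "L2_has_sum (\<lambda>k x. c k * e k x) U"
proof -
  let ?M = "lebesgue_on (cube :: (real ^ 'n) set)"
  define a where "a k = (norm (c k))\<^sup>2" for k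
  define T where "T = infsum a UNIV"
  define S where "S G x = (\<Sum>k\<in>G. c k * e k x)" for G x
  have a_nonneg: "a k \<ge> 0" for k by (simp add: a_def)
  have lim_a: "(sum a \<longlongrightarrow> T) (finite_subsets_at_top UNIV)"
    using summable has_sum_infsum unfolding a_def[symmetric] T_def has_sum_def by blast
  have a_le: "sum a G \<le> T" if "finite G" for G
    unfolding T_def using summable that
    by (intro finite_sum_le_infsum) (auto simp: a_def[symmetric] a_nonneg)
  have S_L2: "S G \<in> L2" for G
    unfolding S_def by (rule trig_sum_in_L2)
  have S_diff: "S G x - S G' x = S (G - G') x" if "finite G" "G' \<subseteq> G" for G G' x
    using sum_diff[OF that, of "\<lambda>k. c k * e k x"] by (simp add: S_def)
  have norm_S: "(L2_norm (S G))\<^sup>2 = sum a G" if "finite G" for G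
    using L2_norm_trig_sum[OF that, of c] by (simp add: S_def[abs_def] a_def)
  have "\<exists>X. finite X \<and> (\<forall>Y. finite Y \<longrightarrow> X \<subseteq> Y \<longrightarrow> T - sum a Y \<le> (1/4) ^ n)" for n
  proof -
    have "\<forall>\<^sub>F Y in finite_subsets_at_top UNIV. dist (sum a Y) T < (1/4) ^ n"
      using lim_a by (rule tendstoD) simp
    then obtain X where X: "finite X"
        "\<And>Y. finite Y \<and> X \<subseteq> Y \<and> Y \<subseteq> UNIV \<Longrightarrow> dist (sum a Y) T < (1/4) ^ n"
      unfolding eventually_finite_subsets_at_top by (elim exE conjE) (rule that, auto)
    have "T - sum a Y \<le> (1/4) ^ n" if "finite Y" "X \<subseteq> Y" for Y
    proof -
      have "\<bar>sum a Y - T\<bar> < (1/4) ^ n"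
        using X(2)[of Y] that by (simp add: dist_real_def)
      then show ?thesis by linarith
    qed
    with X(1) show ?thesis by blast
  qed
  then obtain X where fin_X: "\<And>n. finite (X n)"
    and X: "\<And>n Y. finite Y \<Longrightarrow> X n \<subseteq> Y \<Longrightarrow> T - sum a Y \<le> (1/4) ^ n"
    by metis
  define F where "F n = (\<Union>i\<le>n. X i) \<union> from_nat ` {..n}" for n
  have fin_F: "finite (F n)" for n by (simp add: F_def fin_X)
  have F_mono: "F m \<subseteq> F n" if "m \<le> n" for m n
    using that by (fastforce simp: F_def)
  have F_exhausts: "\<forall>\<^sub>F n in sequentially. G \<subseteq> F n" if "finite G" for G
    using that
  proof (induction G)
    case (insert k G)
    have "\<forall>\<^sub>F n in sequentially. k \<in> F n"
      using eventually_ge_at_top[of "to_nat k"]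
    proof eventually_elim
      case (elim n)
      then have "from_nat (to_nat k) \<in> F n" unfolding F_def by blast
      then show ?case by simp
    qed
    with insert.IH show ?case by eventually_elim simp
  qed simp
  have norm_step: "L2_norm (S (F (Suc n) - F n)) \<le> (1/2) ^ n" for n
  proof (rule power2_le_imp_le)
    have "(L2_norm (S (F (Suc n) - F n)))\<^sup>2 = sum a (F (Suc n)) - sum a (F n)"
      using sum_diff[OF fin_F F_mono[of n "Suc n"], of a] by (simp add: norm_S fin_F)
    also have "\<dots> \<le> T - sum a (F n)" using a_le[OF fin_F] by simp
    also have "\<dots> \<le> (1/4) ^ n" by (rule X[OF fin_F]) (auto simp: F_def)
    also have "\<dots> = ((1/2) ^ n)\<^sup>2" by (simp add: power2_eq_square flip: power_mult_distrib)
    finally show "(L2_norm (S (F (Suc n) - F n)))\<^sup>2 \<le> ((1/2) ^ n)\<^sup>2" .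
  qed simp
  have S_meas [measurable]: "S G \<in> borel_measurable ?M" for G
    using S_L2 by (rule L2_measurable)
  have "AE x in ?M. summable (\<lambda>n. norm (S (F (Suc n) - F n) x))"
  proof -
    have "(\<integral>\<^sup>+x. (\<Sum>n. ennreal (norm (S (F (Suc n) - F n) x))) \<partial>?M)
        = (\<Sum>n. \<integral>\<^sup>+x. ennreal (norm (S (F (Suc n) - F n) x)) \<partial>?M)"
      by (rule nn_integral_suminf) measurable
    also have "\<dots> \<le> (\<Sum>n. ennreal ((1/2) ^ n))"
    proof (rule suminf_le)
      fix n
      have "(\<integral>\<^sup>+x. ennreal (norm (S (F (Suc n) - F n) x)) \<partial>?M)
          = ennreal (LINT x|?M. norm (S (F (Suc n) - F n) x))"
        using L2_integrable[OF S_L2] by (intro nn_integral_eq_integral) auto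
      also have "\<dots> \<le> ennreal ((1/2) ^ n)"
        by (intro ennreal_leI order_trans[OF L2_integral_norm_le[OF S_L2] norm_step])
      finally show "(\<integral>\<^sup>+x. ennreal (norm (S (F (Suc n) - F n) x)) \<partial>?M) \<le> ennreal ((1/2) ^ n)" .
    qed auto
    also have "\<dots> = ennreal (\<Sum>n. (1/2) ^ n)"
      by (intro suminf_ennreal2) (auto intro: summable_geometric)
    also have "\<dots> < \<infinity>" by simp
    finally have "AE x in ?M. (\<Sum>n. ennreal (norm (S (F (Suc n) - F n) x))) \<noteq> \<infinity>"
      by (intro nn_integral_PInf_AE) auto
    then show ?thesis
      by eventually_elim (auto intro!: summable_suminf_not_top)
  qed
  then have conv: "AE x in ?M. convergent (\<lambda>n. S (F n) x)"
  proof eventually_elim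
    case (elim x)
    have "summable (\<lambda>n. S (F (Suc n)) x - S (F n) x)"
      using summable_norm_cancel[OF elim] by (simp add: S_diff fin_F F_mono)
    then have "convergent (\<lambda>n. S (F 0) x + (\<Sum>i<n. S (F (Suc i)) x - S (F i) x))"
      by (intro convergent_add convergent_const) (simp add: summable_iff_convergent)
    then show ?case by (simp add: sum_lessThan_telescope[of "\<lambda>n. S (F n) x"])
  qed
  define U where "U x = lim (\<lambda>n. S (F n) x)" for x
  have [measurable]: "U \<in> borel_measurable ?M"
    unfolding U_def by (rule borel_measurable_lim_metric) measurable
  have lim_U: "AE x in ?M. (\<lambda>n. S (F n) x) \<longlonglongrightarrow> U x"
    using conv by eventually_elim (simp add: U_def convergent_LIMSEQ_iff)
  have fatou: "(\<integral>\<^sup>+x. ennreal ((norm (U x - S G x))\<^sup>2) \<partial>?M) \<le> ennreal (T - sum a G)"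
    if G: "finite G" for G
  proof -
    have "(\<integral>\<^sup>+x. ennreal ((norm (U x - S G x))\<^sup>2) \<partial>?M)
        = (\<integral>\<^sup>+x. liminf (\<lambda>n. ennreal ((norm (S (F n) x - S G x))\<^sup>2)) \<partial>?M)"
    proof (rule nn_integral_cong_AE)
      show "AE x in ?M. ennreal ((norm (U x - S G x))\<^sup>2)
          = liminf (\<lambda>n. ennreal ((norm (S (F n) x - S G x))\<^sup>2))"
        using lim_U
      proof eventually_elim
        case (elim x)
        then have "(\<lambda>n. ennreal ((norm (S (F n) x - S G x))\<^sup>2)) \<longlonglongrightarrow> ennreal ((norm (U x - S G x))\<^sup>2)"
          by (intro tendsto_intros)
        then show ?case by (intro lim_imp_Liminf[symmetric]) auto
      qed
    qed
    also have "\<dots> \<le> liminf (\<lambda>n. \<integral>\<^sup>+x. ennreal ((norm (S (F n) x - S G x))\<^sup>2) \<partial>?M)"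
      by (rule nn_integral_liminf) measurable
    also have "\<dots> \<le> limsup (\<lambda>n. \<integral>\<^sup>+x. ennreal ((norm (S (F n) x - S G x))\<^sup>2) \<partial>?M)"
      by (rule Liminf_le_Limsup) simp
    also have "\<dots> \<le> ennreal (T - sum a G)"
    proof (rule Limsup_bounded)
      show "\<forall>\<^sub>F n in sequentially.
          (\<integral>\<^sup>+x. ennreal ((norm (S (F n) x - S G x))\<^sup>2) \<partial>?M) \<le> ennreal (T - sum a G)"
        using F_exhausts[OF G]
      proof eventually_elim
        case (elim n)
        have "(\<integral>\<^sup>+x. ennreal ((norm (S (F n) x - S G x))\<^sup>2) \<partial>?M)
            = (\<integral>\<^sup>+x. ennreal ((norm (S (F n - G) x))\<^sup>2) \<partial>?M)"
          using elim by (simp add: S_diff fin_F)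
        also have "\<dots> = ennreal ((L2_norm (S (F n - G)))\<^sup>2)"
          unfolding L2_norm_square using L2_integrable_square[OF S_L2]
          by (intro nn_integral_eq_integral) auto
        also have "\<dots> = ennreal (sum a (F n) - sum a G)"
          using elim by (simp add: norm_S fin_F sum_diff)
        also have "\<dots> \<le> ennreal (T - sum a G)"
          using a_le[OF fin_F, of n] by (intro ennreal_leI) simp
        finally show ?case .
      qed
    qed
    finally show ?thesis .
  qed
  have U_L2: "U \<in> L2"
  proof -
    have "(\<integral>\<^sup>+x. ennreal ((norm (U x))\<^sup>2) \<partial>?M) < \<infinity>"
      using fatou[of "{}"] by (simp add: S_def le_less_trans)
    then show ?thesis by (auto simp: L2_def intro!: integrableI_nonneg)
  qed
  have "((\<lambda>G. L2_norm (\<lambda>x. U x - S G x)) \<longlongrightarrow> 0) (finite_subsets_at_top UNIV)"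
  proof (rule Lim_null_comparison)
    show "\<forall>\<^sub>F G in finite_subsets_at_top UNIV. norm (L2_norm (\<lambda>x. U x - S G x)) \<le> sqrt (T - sum a G)"
      using eventually_finite_subsets_at_top_weakI
    proof (rule eventually_mono)
      fix G :: "(int ^ 'n) set" assume G: "finite G"
      have "ennreal ((L2_norm (\<lambda>x. U x - S G x))\<^sup>2) = (\<integral>\<^sup>+x. ennreal ((norm (U x - S G x))\<^sup>2) \<partial>?M)"
        unfolding L2_norm_square using L2_integrable_square[OF L2_diff[OF U_L2 S_L2]]
        by (intro nn_integral_eq_integral[symmetric]) auto
      also have "\<dots> \<le> ennreal (T - sum a G)" by (rule fatou[OF G])
      finally have "(L2_norm (\<lambda>x. U x - S G x))\<^sup>2 \<le> T - sum a G"
        using a_le[OF G] by simp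
      then show "norm (L2_norm (\<lambda>x. U x - S G x)) \<le> sqrt (T - sum a G)"
        using real_le_rsqrt L2_norm_nonneg by auto
    qed
    have "((\<lambda>G. sqrt (T - sum a G)) \<longlongrightarrow> sqrt (T - T)) (finite_subsets_at_top UNIV)"
      by (intro tendsto_intros lim_a)
    then show "((\<lambda>G. sqrt (T - sum a G)) \<longlongrightarrow> 0) (finite_subsets_at_top UNIV)" by simp
  qed
  then have "L2_has_sum (\<lambda>k x. c k * e k x) U"
    unfolding L2_has_sum_def S_def using U_L2 by (auto intro: L2_cmult)
  then show ?thesis by (rule that)
qed

lemma fcoef_L2_has_sum:
  assumes "L2_has_sum (\<lambda>k x. c k * e k x) U"
  shows "fcoef U k = c k"
proof -
  have "((\<lambda>j. L2_inner (\<lambda>x. c j * e j x) (e k)) has_sum L2_inner U (e k)) UNIV"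
    using assms by (rule L2_has_sum_imp_inner_has_sum) simp
  also have "(\<lambda>j. L2_inner (\<lambda>x. c j * e j x) (e k)) = (\<lambda>j. if j = k then c k else 0)"
    by (auto simp: L2_inner_cmult_left e_orthonormal)
  finally have "((\<lambda>j. if j = k then c k else 0) has_sum fcoef U k) UNIV"
    by (simp add: fcoef_def)
  moreover have "((\<lambda>j. if j = k then c k else 0) has_sum c k) UNIV"
    using has_sum_finite_neutralI[of "{k}" UNIV "\<lambda>j. if j = k then c k else 0" "c k"] by auto
  ultimately show ?thesis by (metis has_sum_unique)
qed

section \<open>Completeness of the trigonometric system\<close>

text \<open>
  The linear span of the functions \<open>e k\<close>. It is an algebra, and it contains every real
  polynomial in the real and imaginary parts of the coordinates of \<open>torus x\<close>.
\<close>

inductive trig_poly :: "(real ^ 'n \<Rightarrow> complex) \<Rightarrow> bool" where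
  monomial: "trig_poly (\<lambda>x. c * e k x)"
| add: "trig_poly p \<Longrightarrow> trig_poly q \<Longrightarrow> trig_poly (\<lambda>x. p x + q x)"

lemma trig_poly_monomial_mult:
  assumes "trig_poly q" shows "trig_poly (\<lambda>x. c * e k x * q x)"
  using assms
proof induction
  case (monomial d j)
  have "(\<lambda>x. c * e k x * (d * e j x)) = (\<lambda>x. (c * d) * e (k + j) x)"
    by (simp add: mult_ac flip: e_mult)
  then show ?case by (metis trig_poly.monomial)
next
  case (add p q)
  then show ?case by (simp add: distrib_left trig_poly.add)
qed

lemma trig_poly_mult:
  assumes "trig_poly p" "trig_poly q" shows "trig_poly (\<lambda>x. p x * q x)"
  using assms
  by induction (simp_all add: trig_poly_monomial_mult distrib_right trig_poly.add)

lemma trig_poly_const: "trig_poly (\<lambda>x. c)"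
  using trig_poly.monomial[of c 0] by simp

lemma trig_poly_sum:
  assumes "finite I" "\<And>i. trig_poly (p i)"
  shows "trig_poly (\<lambda>x. \<Sum>i\<in>I. p i x)"
  using assms(1)
proof (induction I)
  case empty
  show ?case unfolding sum.empty by (rule trig_poly_const)
next
  case (insert i I)
  show ?case unfolding sum.insert[OF insert.hyps]
    by (rule trig_poly.add[OF assms(2) insert.IH])
qed

lemma trig_poly_L2: "trig_poly p \<Longrightarrow> p \<in> L2"
  by (induction rule: trig_poly.induct) (auto intro: L2_add L2_cmult)

text \<open>
  The parametrization of the torus by the cube. It identifies opposite faces of the closed
  cube, so a function is a continuous function of \<open>torus x\<close> only if it is periodic.
\<close>

definition torus :: "real ^ 'n \<Rightarrow> complex ^ 'n" where
  "torus x = (\<chi> i. cis (2 * pi * x $ i))"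

lemma continuous_on_torus: "continuous_on A torus"
  unfolding torus_def by (intro continuous_intros)

lemma e_axis: "e (axis i n) x = cis (2 * pi * (of_int n * x $ i))"
proof -
  have "freq (axis i n) = axis i (of_int n)"
    by (simp add: freq_def vec_eq_iff axis_def)
  then show ?thesis by (simp add: e_eq_cis inner_axis')
qed

lemma trig_poly_linear_torus:
  fixes L :: "complex ^ 'n \<Rightarrow> real"
  assumes "bounded_linear L"
  shows "trig_poly (\<lambda>x. complex_of_real (L (torus x)))"
proof -
  interpret bounded_linear L by fact
  define P where "P i = L (axis i 1)" for i
  define Q where "Q i = L (axis i \<i>)" for i
  have "L z = (\<Sum>i\<in>UNIV. Re (z $ i) * P i + Im (z $ i) * Q i)" for z
  proof -
    have "z = (\<Sum>i\<in>UNIV. axis i (z $ i))"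
      by (simp add: vec_eq_iff axis_def)
    also have "\<dots> = (\<Sum>i\<in>UNIV. Re (z $ i) *\<^sub>R axis i 1 + Im (z $ i) *\<^sub>R axis i \<i>)"
      by (intro sum.cong refl) (auto simp: vec_eq_iff axis_def complex_eq_iff)
    finally have "L z = L (\<Sum>i\<in>UNIV. Re (z $ i) *\<^sub>R axis i 1 + Im (z $ i) *\<^sub>R axis i \<i>)"
      by simp
    then show ?thesis
      by (simp add: P_def Q_def add scaleR sum)
  qed
  then have "complex_of_real (L (torus x)) =
      (\<Sum>i\<in>UNIV. of_real (P i / 2) * (e (axis i 1) x + e (axis i (- 1)) x)
        + (- \<i> * of_real (Q i / 2)) * (e (axis i 1) x + - 1 * e (axis i (- 1)) x))" for x
    by (simp add: torus_def e_axis complex_eq_iff algebra_simps)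
  moreover have "trig_poly (\<lambda>x. \<Sum>i\<in>UNIV. of_real (P i / 2) * (e (axis i 1) x + e (axis i (- 1)) x)
        + (- \<i> * of_real (Q i / 2)) * (e (axis i 1) x + - 1 * e (axis i (- 1)) x))"
    by (intro trig_poly_sum finite trig_poly.add trig_poly_mult trig_poly_const trig_poly.monomial
        trig_poly.monomial[of 1, simplified])
  ultimately show ?thesis by presburger
qed

lemma trig_poly_polynomial_torus:
  "real_polynomial_function p \<Longrightarrow> trig_poly (\<lambda>x. complex_of_real (p (torus x)))"
  by (induction rule: real_polynomial_function.induct)
     (auto intro: trig_poly_linear_torus trig_poly_const trig_poly.add trig_poly_mult)

text \<open>A point of the open cube is identified with no other point of the closed cube.\<close>

lemma torus_eq_in_cube:
  assumes "x \<in> cube" "y \<in> cbox 0 (\<chi> i. 1)" "torus x = torus y"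
  shows "x = y"
proof -
  have "x $ i = y $ i" for i
  proof -
    have xy: "0 < x $ i" "x $ i < 1" "0 \<le> y $ i" "y $ i \<le> 1"
      using assms(1,2) by (auto simp: cube_def mem_box_cart)
    have "cis (2 * pi * x $ i) = cis (2 * pi * y $ i)"
      using assms(3) by (simp add: torus_def vec_eq_iff)
    then have "cis (2 * pi * (x $ i - y $ i)) = 1"
      by (simp add: right_diff_distrib flip: cis_divide)
    then have "exp (\<i> * of_real (2 * pi * (x $ i - y $ i))) = 1"
      by (simp add: cis_conv_exp)
    then obtain n :: int where "2 * pi * (x $ i - y $ i) = of_int n * (2 * pi)"
      by (auto simp: exp_eq_1)
    then have n: "x $ i - y $ i = of_int n" by simp
    then have "\<bar>of_int n\<bar> < (1 :: real)" using xy by linarith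
    then have "n = 0" by linarith
    with n show ?thesis by simp
  qed
  then show ?thesis by (simp add: vec_eq_iff)
qed

lemma L2_integrable_indicator_borel:
  fixes u :: "real ^ 'k \<Rightarrow> complex"
  assumes "u \<in> L2" "A \<in> sets borel"
  shows "integrable (lebesgue_on cube) (\<lambda>x. indicator A x *\<^sub>R u x)"
proof -
  have "A \<inter> cube \<in> sets (lebesgue_on cube)"
    using assms(2) by (auto simp: sets_restrict_space image_iff intro!: bexI[of _ A])
  then have "integrable (lebesgue_on cube) (\<lambda>x. indicator (A \<inter> cube) x *\<^sub>R u x)"
    by (intro integrable_mult_indicator L2_integrable assms(1))
  then show ?thesis
    by (rule Bochner_Integration.integrable_cong[THEN iffD1, rotated 2]) (auto simp: indicator_def)
qed

text \<open>
  A square-integrable function that is orthogonal to every \<open>e k\<close> vanishes almost everywhere.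
  The next lemmas enlarge the class of functions whose product with it has integral zero:
  trigonometric polynomials, continuous functions of \<open>torus x\<close>, and indicators of open
  and finally of Borel sets.
\<close>

context
  fixes f :: "real ^ 'n \<Rightarrow> complex"
  assumes f_L2: "f \<in> L2" and f_coef: "\<And>k. fcoef f k = 0"
begin

lemma integral_mult_e_eq_0: "(LINT x|lebesgue_on cube. f x * e k x) = 0"
  using f_coef[of "- k"] e_mult_cnj[of 0 _ "- k"] by (simp add: fcoef_def L2_inner_def)

lemma integral_mult_trig_poly_eq_0: "trig_poly p \<Longrightarrow> (LINT x|lebesgue_on cube. f x * p x) = 0"
proof (induction rule: trig_poly.induct)
  case (monomial c k)
  then show ?case using integral_mult_e_eq_0[of k] by (simp add: mult.left_commute[of _ c])
next
  case (add p q)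
  then show ?case
    by (simp add: distrib_left L2_integrable_mult f_L2 trig_poly_L2)
qed

lemma integral_mult_continuous_torus_eq_0:
  fixes G :: "complex ^ 'n \<Rightarrow> real"
  assumes G: "continuous_on UNIV G"
  shows "(LINT x|lebesgue_on cube. f x * of_real (G (torus x))) = 0"
proof -
  let ?M = "lebesgue_on (cube :: (real ^ 'n) set)"
  let ?I = "LINT x|?M. f x * of_real (G (torus x))"
  have GT: "(\<lambda>x. complex_of_real (G (torus x))) \<in> L2"
    by (intro L2_continuous continuous_on_of_real continuous_on_compose2[OF G continuous_on_torus]) auto
  have bound: "norm ?I \<le> \<epsilon> * L2_norm f" if "\<epsilon> > 0" for \<epsilon>
  proof -
    have "compact (torus ` cbox 0 (\<chi> i. 1))"
      by (intro compact_continuous_image continuous_on_torus compact_cbox)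
    then obtain p where p: "real_polynomial_function p"
        "\<And>z. z \<in> torus ` cbox 0 (\<chi> i. 1) \<Longrightarrow> \<bar>G z - p z\<bar> < \<epsilon>"
      using Stone_Weierstrass_real_polynomial_function[OF _ continuous_on_subset[OF G] \<open>\<epsilon> > 0\<close>]
      by (metis subset_UNIV)
    have tp: "trig_poly (\<lambda>x. complex_of_real (p (torus x)))"
      by (rule trig_poly_polynomial_torus[OF p(1)])
    have "?I = (LINT x|?M. f x * of_real (G (torus x))) - (LINT x|?M. f x * of_real (p (torus x)))"
      using integral_mult_trig_poly_eq_0[OF tp] by simp
    also have "\<dots> = (LINT x|?M. f x * of_real (G (torus x)) - f x * of_real (p (torus x)))"
      by (intro Bochner_Integration.integral_diff[symmetric] L2_integrable_mult f_L2 GT trig_poly_L2[OF tp])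
    finally have I_eq: "?I = (LINT x|?M. f x * of_real (G (torus x)) - f x * of_real (p (torus x)))" .
    have "norm ?I \<le> (LINT x|?M. norm (f x * of_real (G (torus x)) - f x * of_real (p (torus x))))"
      unfolding I_eq by (rule integral_norm_bound)
    also have "\<dots> \<le> (LINT x|?M. \<epsilon> * norm (f x))"
    proof (rule integral_mono)
      show "integrable ?M (\<lambda>x. norm (f x * of_real (G (torus x)) - f x * of_real (p (torus x))))"
        by (intro integrable_norm Bochner_Integration.integrable_diff L2_integrable_mult f_L2 GT trig_poly_L2[OF tp])
      show "integrable ?M (\<lambda>x. \<epsilon> * norm (f x))"
        by (intro integrable_mult_right integrable_norm L2_integrable f_L2)
      fix x :: "real ^ 'n" assume "x \<in> space ?M"
      then have "\<bar>G (torus x) - p (torus x)\<bar> \<le> \<epsilon>"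
        using box_subset_cbox by (intro less_imp_le p(2) imageI) (auto simp: cube_eq_box)
      then have "norm (f x) * \<bar>G (torus x) - p (torus x)\<bar> \<le> norm (f x) * \<epsilon>"
        by (rule mult_left_mono) simp
      then show "norm (f x * of_real (G (torus x)) - f x * of_real (p (torus x))) \<le> \<epsilon> * norm (f x)"
        by (simp add: norm_mult mult.commute flip: right_diff_distrib of_real_diff)
    qed
    also have "\<dots> \<le> \<epsilon> * L2_norm f"
      using L2_integral_norm_le[OF f_L2] that by simp
    finally show ?thesis .
  qed
  have "((\<lambda>\<epsilon>. \<epsilon> * L2_norm f) \<longlongrightarrow> 0 * L2_norm f) (at_right 0)"
    by (intro tendsto_intros)
  moreover have "\<forall>\<^sub>F \<epsilon> in at_right 0. norm ?I \<le> \<epsilon> * L2_norm f"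
    using eventually_at_right_less by (rule eventually_mono) (rule bound)
  ultimately have "norm ?I \<le> 0 * L2_norm f"
    by (rule tendsto_lowerbound) simp
  then show ?thesis by simp
qed

text \<open>
  The indicator of an open subset \<open>U\<close> of the cube is, on the cube, a bounded pointwise limit
  of continuous functions of \<open>torus x\<close>: apply a cut-off to the distance from the compact
  image \<open>K\<close> of the complement of \<open>U\<close> in the closed cube. No point of \<open>U\<close> is mapped into
  \<open>K\<close>, because identifications happen only on the boundary of the cube.
\<close>

lemma integral_open_eq_0:
  assumes "open U" "U \<subseteq> cube"
  shows "(LINT x|lebesgue_on cube. indicator U x *\<^sub>R f x) = 0"
proof -
  let ?M = "lebesgue_on (cube :: (real ^ 'n) set)"
  define K where "K = torus ` (cbox 0 (\<chi> i. 1) - U)"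
  have "compact K"
    unfolding K_def
    by (intro compact_continuous_image continuous_on_torus compact_diff compact_cbox assms)
  then have "closed K" by (rule compact_imp_closed)
  have "(0 :: real ^ 'n) \<notin> cube" by (simp add: cube_def)
  \<comment> \<open>\<open>infdist\<close> to the empty set is 0 by convention, so \<open>K\<close> has to be nonempty\<close>
  then have "0 \<in> cbox 0 (\<chi> i. 1) - U" using assms(2) by (auto simp: mem_box_cart)
  then have "K \<noteq> {}" by (auto simp: K_def)
  define G where "G n z = min 1 (real n * infdist z K)" for n z
  have G_cont: "continuous_on UNIV (G n)" for n
    unfolding G_def by (intro continuous_intros)
  have G_bound: "0 \<le> G n z" "G n z \<le> 1" for n z
    by (auto simp: G_def infdist_nonneg)
  have G_lim: "(\<lambda>n. G n (torus x)) \<longlonglongrightarrow> indicator U x" if x: "x \<in> cube" for x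
  proof (cases "x \<in> U")
    case True
    have "torus x \<notin> K"
      using torus_eq_in_cube[OF x] True by (auto simp: K_def)
    then have pos: "infdist (torus x) K > 0"
      using \<open>closed K\<close> \<open>K \<noteq> {}\<close> infdist_pos_not_in_closed by blast
    have "\<forall>\<^sub>F n in sequentially. 1 \<le> real n * infdist (torus x) K"
      using filterlim_tendsto_pos_mult_at_top[OF tendsto_const pos filterlim_real_sequentially]
      by (simp add: filterlim_at_top mult.commute)
    then have "\<forall>\<^sub>F n in sequentially. G n (torus x) = 1"
      by eventually_elim (simp add: G_def)
    then show ?thesis using True by (simp add: tendsto_eventually)
  next
    case False
    then have "torus x \<in> K"
      using x box_subset_cbox by (auto simp: K_def cube_eq_box)
    then show ?thesis using False by (simp add: G_def)
  qed
  have U_sets: "U \<in> sets ?M"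
    using assms by (auto simp: sets_restrict_space image_iff intro!: exI[of _ U])
  have "(\<lambda>n. LINT x|?M. f x * of_real (G n (torus x))) \<longlonglongrightarrow> (LINT x|?M. indicator U x *\<^sub>R f x)"
  proof (rule integral_dominated_convergence[where w = "\<lambda>x. norm (f x)"])
    show "(\<lambda>x. indicator U x *\<^sub>R f x) \<in> borel_measurable ?M"
      using f_L2[THEN L2_measurable] U_sets by measurable
    show "(\<lambda>x. f x * of_real (G n (torus x))) \<in> borel_measurable ?M" for n
      by (intro borel_measurable_times L2_measurable[OF f_L2] measurable_lebesgue_on_cube
          borel_measurable_continuous_onI continuous_on_of_real
          continuous_on_compose2[OF G_cont continuous_on_torus]) auto
    show "integrable ?M (\<lambda>x. norm (f x))"
      by (intro integrable_norm L2_integrable f_L2)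
    show "AE x in ?M. (\<lambda>n. f x * of_real (G n (torus x))) \<longlonglongrightarrow> indicator U x *\<^sub>R f x"
    proof (rule AE_I2)
      fix x assume "x \<in> space ?M"
      then have "(\<lambda>n. f x * of_real (G n (torus x))) \<longlonglongrightarrow> f x * of_real (indicator U x)"
        by (intro tendsto_intros G_lim) simp
      then show "(\<lambda>n. f x * of_real (G n (torus x))) \<longlonglongrightarrow> indicator U x *\<^sub>R f x"
        by (simp add: scaleR_conv_of_real mult.commute)
    qed
    show "AE x in ?M. norm (f x * of_real (G n (torus x))) \<le> norm (f x)" for n
      using G_bound by (auto simp: norm_mult mult_left_le)
  qed
  then show ?thesis
    by (simp add: integral_mult_continuous_torus_eq_0[OF G_cont] LIMSEQ_const_iff)
qed

lemma integral_borel_eq_0: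
  assumes "A \<in> sets borel"
  shows "(LINT x|lebesgue_on cube. indicator A x *\<^sub>R f x) = 0"
proof -
  let ?M = "lebesgue_on (cube :: (real ^ 'n) set)"
  note int = L2_integrable_indicator_borel[OF f_L2]
  have open_case: "(LINT x|?M. indicator U x *\<^sub>R f x) = 0" if "open U" for U
  proof -
    have "(LINT x|?M. indicator U x *\<^sub>R f x) = (LINT x|?M. indicator (U \<inter> cube) x *\<^sub>R f x)"
      by (intro Bochner_Integration.integral_cong) (auto simp: indicator_def)
    also have "\<dots> = 0"
      by (rule integral_open_eq_0) (auto simp: that cube_eq_box)
    finally show ?thesis .
  qed
  have sb: "sets borel = sigma_sets UNIV {U :: (real ^ 'n) set. open U}"
    by (simp add: borel_def)
  have "Int_stable {U :: (real ^ 'n) set. open U}"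
    by (auto simp: Int_stable_def)
  moreover have "{U :: (real ^ 'n) set. open U} \<subseteq> Pow UNIV" by simp
  moreover have "A \<in> sigma_sets UNIV {U. open U}" using assms sb by simp
  ultimately show ?thesis
  proof (induction rule: sigma_sets_induct_disjoint)
    case (basic U)
    then show ?case by (simp add: open_case)
  next
    case empty
    show ?case by simp
  next
    case (compl A)
    have A: "A \<in> sets borel" using compl(1) sb by simp
    have "(LINT x|?M. indicator (UNIV - A) x *\<^sub>R f x)
        = (LINT x|?M. indicator UNIV x *\<^sub>R f x - indicator A x *\<^sub>R f x)"
      by (intro Bochner_Integration.integral_cong) (auto simp: indicator_def)
    also have "\<dots> = (LINT x|?M. indicator UNIV x *\<^sub>R f x) - (LINT x|?M. indicator A x *\<^sub>R f x)"
      by (intro Bochner_Integration.integral_diff int A) auto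
    also have "\<dots> = 0" unfolding compl.IH by (subst open_case) auto
    finally show ?case .
  next
    case (union B)
    have B: "B i \<in> sets borel" for i using union(2) sb by auto
    have "(\<lambda>n. LINT x|?M. indicator (\<Union>i<n. B i) x *\<^sub>R f x)
        \<longlonglongrightarrow> (LINT x|?M. indicator (\<Union>i. B i) x *\<^sub>R f x)"
    proof (rule integral_dominated_convergence[where w = "\<lambda>x. norm (f x)"])
      show "integrable ?M (\<lambda>x. norm (f x))"
        by (intro integrable_norm L2_integrable f_L2)
      show "(\<lambda>x. indicator (\<Union>i. B i) x *\<^sub>R f x) \<in> borel_measurable ?M"
        by (intro borel_measurable_integrable int) (use B in auto)
      show "(\<lambda>x. indicator (\<Union>i<n. B i) x *\<^sub>R f x) \<in> borel_measurable ?M" for n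
        by (intro borel_measurable_integrable int) (use B in auto)
      show "AE x in ?M. (\<lambda>n. indicator (\<Union>i<n. B i) x *\<^sub>R f x) \<longlonglongrightarrow> indicator (\<Union>i. B i) x *\<^sub>R f x"
        by (intro AE_I2 tendsto_scaleR LIMSEQ_indicator_UN tendsto_const)
      show "AE x in ?M. norm (indicator (\<Union>i<n. B i) x *\<^sub>R f x) \<le> norm (f x)" for n
        by (auto simp: indicator_def)
    qed
    moreover have "(LINT x|?M. indicator (\<Union>i<n. B i) x *\<^sub>R f x) = 0" for n
    proof -
      have "indicator (\<Union>i<n. B i) x = (\<Sum>i<n. indicator (B i) x :: real)" for x
        using union(1) by (intro indicator_UN_disjoint) (auto simp: disjoint_family_on_def)
      then have "(LINT x|?M. indicator (\<Union>i<n. B i) x *\<^sub>R f x)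
          = (LINT x|?M. (\<Sum>i<n. indicator (B i) x *\<^sub>R f x))"
        by (simp add: scaleR_sum_left)
      also have "\<dots> = (\<Sum>i<n. LINT x|?M. indicator (B i) x *\<^sub>R f x)"
        by (intro Bochner_Integration.integral_sum int B)
      also have "\<dots> = 0" using union.IH by simp
      finally show ?thesis .
    qed
    ultimately show ?case by (simp add: LIMSEQ_const_iff)
  qed
qed

lemma AE_eq_0_of_fcoef_eq_0: "AE x in lebesgue_on cube. f x = 0"
proof -
  let ?M = "lebesgue_on (cube :: (real ^ 'n) set)"
  interpret finite_measure ?M by (rule finite_measure_cube)
  show ?thesis
  proof (rule density_zero)
  show "integrable ?M f" by (intro L2_integrable f_L2)
  fix A assume A: "A \<in> sets ?M"
  \<comment> \<open>a Lebesgue set is a Borel set up to a null set\<close>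
  then have "A \<in> sets lebesgue" by (auto simp: sets_restrict_space)
  then obtain C N where CN: "fsigma C" "N \<in> null_sets lebesgue" "C \<union> N = A"
    by (rule lebesgue_set_almost_fsigma)
  have C: "C \<in> sets borel" using CN(1) by (cases rule: fsigma.cases) auto
  have "AE x in lebesgue. x \<notin> N"
    using CN(2) by (rule AE_not_in)
  then have "AE x in ?M. x \<notin> N"
    by (subst AE_restrict_space_iff) auto
  then have AE: "AE x in ?M. indicator A x *\<^sub>R f x = indicator C x *\<^sub>R f x"
    by eventually_elim (use CN(3) in \<open>auto simp: indicator_def\<close>)
  have "(LINT x|?M. indicator A x *\<^sub>R f x) = (LINT x|?M. indicator C x *\<^sub>R f x)"
    by (intro integral_cong_AE AE borel_measurable_integrable integrable_mult_indicator A
        L2_integrable L2_integrable_indicator_borel f_L2 C)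
  then show "set_lebesgue_integral ?M A f = 0"
    unfolding set_lebesgue_integral_def by (simp add: integral_borel_eq_0[OF C])
  qed
qed

end

text \<open>
  Completeness of the system: the Fourier series of \<open>f\<close> converges to some \<open>U\<close> by the
  Riesz-Fischer theorem, and \<open>f - U\<close> has no nonzero Fourier coefficient.
\<close>

theorem Fourier_series_L2:
  assumes "f \<in> L2"
  shows "L2_has_sum (\<lambda>k x. fcoef f k * e k x) f"
proof -
  obtain U where U: "L2_has_sum (\<lambda>k x. fcoef f k * e k x) U"
    using Riesz_Fischer[OF fcoef_square_summable[OF assms]] .
  then have U_L2: "U \<in> L2" by (simp add: L2_has_sum_def)
  have "fcoef (\<lambda>x. f x - U x) k = 0" for k
    using fcoef_L2_has_sum[OF U] by (simp add: fcoef_def L2_inner_diff_left assms U_L2)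
  then have "AE x in lebesgue_on cube. f x - U x = 0"
    by (intro AE_eq_0_of_fcoef_eq_0 L2_diff assms U_L2)
  then have eq: "L2_norm (\<lambda>x. f x - (\<Sum>k\<in>F. fcoef f k * e k x))
      = L2_norm (\<lambda>x. U x - (\<Sum>k\<in>F. fcoef f k * e k x))" for F
    unfolding L2_norm_def
    by (intro arg_cong[where f = sqrt] integral_cong_AE borel_measurable_integrable
       L2_integrable_square L2_diff assms U_L2 trig_sum_in_L2) (auto elim!: eventually_mono)
  show ?thesis using U unfolding L2_has_sum_def eq by (simp add: assms)
qed

theorem Parseval:
  assumes "u \<in> L2" "v \<in> L2"
  shows "((\<lambda>k. fcoef u k * cnj (fcoef v k)) has_sum L2_inner u v) UNIV"
  using L2_has_sum_imp_inner_has_sum[OF Fourier_series_L2[OF assms(1)] assms(2)]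
  by (simp add: L2_inner_cmult_left fcoef_def L2_inner_commute[of v])

section \<open>Weak derivatives of Fourier series\<close>

lemma partial_eq: "(f has_derivative f') (at x) \<Longrightarrow> partial i f x = f' (axis i 1)"
  by (simp add: partial_def flip: frechet_derivative_at)

lemma has_derivative_partial:
  assumes "f differentiable (at (x + t *\<^sub>R axis i 1))"
  shows "((\<lambda>s. f (x + s *\<^sub>R axis i 1)) has_derivative
    (\<lambda>s. s *\<^sub>R partial i f (x + t *\<^sub>R axis i 1))) (at t)"
proof -
  let ?y = "x + t *\<^sub>R axis i 1"
  let ?f' = "frechet_derivative f (at ?y)"
  have f': "(f has_derivative ?f') (at ?y)"
    using assms by (simp add: frechet_derivative_works)
  have "((\<lambda>s. x + s *\<^sub>R axis i 1) has_derivative (\<lambda>s. s *\<^sub>R axis i 1)) (at t)"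
    by (auto intro!: derivative_eq_intros)
  from has_derivative_compose[OF this f']
  have "((\<lambda>s. f (x + s *\<^sub>R axis i 1)) has_derivative (\<lambda>s. ?f' (s *\<^sub>R axis i 1))) (at t)" .
  moreover have "?f' (s *\<^sub>R axis i 1) = s *\<^sub>R partial i f ?y" for s
    using linear_cmul[OF has_derivative_linear[OF f']] by (simp add: partial_def)
  ultimately show ?thesis by simp
qed

lemma partial_eq_0_outside_closure:
  assumes "x \<notin> closure {x. f x \<noteq> 0}"
  shows "partial i f x = 0"
proof -
  have "(f has_derivative (\<lambda>_. 0)) (at x)"
  proof (rule has_derivative_transform_within_open)
    show "open (- closure {x. f x \<noteq> 0})" by auto
    show "x \<in> - closure {x. f x \<noteq> 0}" using assms by simp
    show "((\<lambda>_. 0) has_derivative (\<lambda>_. 0)) (at x)" by (rule has_derivative_const)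
    show "0 = f y" if "y \<in> - closure {x. f x \<noteq> 0}" for y
      using that closure_subset[of "{x. f x \<noteq> 0}"] by auto
  qed
  then show ?thesis by (simp add: partial_eq)
qed

text \<open>
  The integral of a partial derivative of a compactly supported function vanishes: the
  difference quotients have integral zero by translation invariance, and they converge
  dominatedly to the derivative.
\<close>

lemma integral_partial_eq_0:
  fixes f :: "real ^ 'n \<Rightarrow> complex"
  assumes diff: "\<And>x. f differentiable (at x)"
    and cont: "continuous_on UNIV (partial i f)"
    and supp: "compact (closure {x. f x \<noteq> 0})"
  shows "(LINT x|lborel. partial i f x) = 0"
proof -
  let ?a = "axis i 1 :: real ^ 'n"
  let ?h = "\<lambda>n. inverse (real (Suc n))"
  let ?q = "\<lambda>n x. (f (x + ?h n *\<^sub>R ?a) - f x) /\<^sub>R ?h n"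
  obtain R where R: "\<And>x. x \<in> closure {x. f x \<noteq> 0} \<Longrightarrow> norm x \<le> R"
    using compact_imp_bounded[OF supp] unfolding bounded_iff by blast
  have f_out: "f x = 0" if "norm x > R" for x
    using that R[of x] closure_subset[of "{x. f x \<noteq> 0}"] by force
  have p_out: "partial i f x = 0" if "norm x > R" for x
    using that R[of x] by (intro partial_eq_0_outside_closure) force
  have f_cont: "continuous_on A f" for A
    by (intro continuous_at_imp_continuous_on ballI differentiable_imp_continuous_within diff)
  have "bounded (partial i f ` cball 0 R)"
    by (intro compact_imp_bounded compact_continuous_image continuous_on_subset[OF cont]) auto
  then obtain B0 where B0: "\<And>x. x \<in> cball 0 R \<Longrightarrow> norm (partial i f x) \<le> B0"
    unfolding bounded_iff by blast
  define B where "B = max 0 B0"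
  have B: "norm (partial i f x) \<le> B" for x
    using B0[of x] p_out[of x] by (cases "norm x \<le> R") (auto simp: B_def)
  have f_int: "integrable lborel f"
  proof -
    have "integrable lborel (\<lambda>x. indicator (cball 0 R) x *\<^sub>R f x)"
      by (intro borel_integrable_compact f_cont) auto
    also have "(\<lambda>x. indicator (cball 0 R) x *\<^sub>R f x) = f"
      using f_out by (fastforce simp: indicator_def)
    finally show ?thesis .
  qed
  have f_meas: "f \<in> borel_measurable borel"
    by (rule borel_measurable_continuous_onI[OF f_cont])
  have shift_int: "integrable lborel (\<lambda>x. f (x + c))"
    and shift: "(LINT x|lborel. f (x + c)) = (LINT x|lborel. f x)" for c
  proof -
    have "integrable (distr lborel borel ((+) c)) f"
      using f_int by (simp add: lborel_distr_plus)
    then show "integrable lborel (\<lambda>x. f (x + c))"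
      by (subst (asm) integrable_distr_eq) (use f_meas in \<open>auto simp: add.commute\<close>)
    have "(LINT x|lborel. f x) = (LINT x|distr lborel borel ((+) c). f x)"
      by (simp add: lborel_distr_plus)
    also have "\<dots> = (LINT x|lborel. f (x + c))"
      by (subst integral_distr) (use f_meas in \<open>auto simp: add.commute\<close>)
    finally show "(LINT x|lborel. f (x + c)) = (LINT x|lborel. f x)" by simp
  qed
  have "(\<lambda>n. LINT x|lborel. ?q n x) \<longlonglongrightarrow> (LINT x|lborel. partial i f x)"
  proof (rule integral_dominated_convergence[where w = "\<lambda>x. B * indicator (cball 0 (R + 1)) x"])
    show "partial i f \<in> borel_measurable lborel"
      using borel_measurable_continuous_onI[OF cont] by simp
    show "?q n \<in> borel_measurable lborel" for n
      by (intro borel_measurable_integrable integrable_scaleR_right Bochner_Integration.integrable_diff shift_int f_int)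
    have "emeasure lborel (cball 0 (R + 1) :: (real ^ 'n) set) < \<infinity>"
      by (intro emeasure_bounded_finite) simp
    then show "integrable lborel (\<lambda>x :: real ^ 'n. B * indicator (cball 0 (R + 1)) x)"
      by (intro integrable_mult_right integrable_real_indicator) auto
    show "AE x in lborel. (\<lambda>n. ?q n x) \<longlonglongrightarrow> partial i f x"
    proof (rule AE_I2)
      fix x :: "real ^ 'n"
      have "((\<lambda>s. norm (f (x + (0 + s) *\<^sub>R ?a) - f (x + 0 *\<^sub>R ?a) - s *\<^sub>R partial i f (x + 0 *\<^sub>R ?a)) / norm s) \<longlongrightarrow> 0) (at 0)"
        using has_derivative_partial[OF diff, where x = x and t = 0 and i = i] unfolding has_derivative_at by blast
      moreover have "filterlim ?h (at 0) sequentially"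
        unfolding filterlim_at using LIMSEQ_inverse_real_of_nat by simp
      ultimately have "(\<lambda>n. norm (f (x + (0 + ?h n) *\<^sub>R ?a) - f (x + 0 *\<^sub>R ?a)
          - ?h n *\<^sub>R partial i f (x + 0 *\<^sub>R ?a)) / norm (?h n)) \<longlonglongrightarrow> 0"
        by (rule filterlim_compose)
      moreover have "norm (f (x + (0 + ?h n) *\<^sub>R ?a) - f (x + 0 *\<^sub>R ?a)
          - ?h n *\<^sub>R partial i f (x + 0 *\<^sub>R ?a)) / norm (?h n) = norm (?q n x - partial i f x)" for n
      proof -
        have "?q n x - partial i f x = (f (x + ?h n *\<^sub>R ?a) - f x - ?h n *\<^sub>R partial i f x) /\<^sub>R ?h n"
          by (simp add: scaleR_diff_right del: of_nat_Suc)
        then show ?thesis by (simp add: divide_inverse mult.commute)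
      qed
      ultimately have "(\<lambda>n. norm (?q n x - partial i f x)) \<longlonglongrightarrow> 0" by simp
      then show "(\<lambda>n. ?q n x) \<longlonglongrightarrow> partial i f x"
        by (simp only: tendsto_norm_zero_iff LIM_zero_iff)
    qed
    show "AE x in lborel. norm (?q n x) \<le> B * indicator (cball 0 (R + 1)) x" for n
    proof (rule AE_I2)
      fix x :: "real ^ 'n"
      have h: "0 < ?h n" "?h n \<le> 1" by (auto simp: inverse_le_1_iff)
      show "norm (?q n x) \<le> B * indicator (cball 0 (R + 1)) x"
      proof (cases "norm x \<le> R + 1")
        case True
        have "norm (f (x + ?h n *\<^sub>R ?a) - f (x + 0 *\<^sub>R ?a)) \<le> B * norm (?h n - 0)"
        proof (rule differentiable_bound[where S = UNIV])
          show "((\<lambda>s. f (x + s *\<^sub>R ?a)) has_derivative (\<lambda>s. s *\<^sub>R partial i f (x + t *\<^sub>R ?a)))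
              (at t within UNIV)" for t
            using has_derivative_partial[OF diff] by simp
          show "onorm (\<lambda>s. s *\<^sub>R partial i f (x + t *\<^sub>R ?a)) \<le> B" for t
            by (rule onorm_le) (simp add: mult.commute[of B] mult_left_mono B)
        qed auto
        then have "norm (f (x + ?h n *\<^sub>R ?a) - f x) / ?h n \<le> B"
          using h by (simp add: pos_divide_le_eq del: of_nat_Suc)
        then show ?thesis using True by (simp add: divide_inverse mult.commute)
      next
        case False
        have "norm x \<le> norm (x + ?h n *\<^sub>R ?a) + norm (?h n *\<^sub>R ?a)"
          by (metis add_diff_cancel_right' norm_triangle_ineq4)
        then have "norm (x + ?h n *\<^sub>R ?a) > R"
          using False h by (simp add: norm_axis_1 del: of_nat_Suc)
        then show ?thesis using False f_out[of x] f_out[of "x + ?h n *\<^sub>R ?a"] by simp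
      qed
    qed
  qed
  moreover have "(LINT x|lborel. ?q n x) = 0" for n
    using shift[of "?h n *\<^sub>R ?a"]
    by (simp add: Bochner_Integration.integral_diff[OF shift_int f_int] del: of_nat_Suc)
  ultimately show ?thesis by (simp add: LIMSEQ_const_iff del: of_nat_Suc)
qed

lemma test_function_differentiable: "\<phi> \<in> test_functions \<Longrightarrow> \<phi> differentiable (at x)"
  unfolding test_functions_def smooth_def by (force dest: spec[of _ "[]"])

lemma test_function_continuous: "\<phi> \<in> test_functions \<Longrightarrow> continuous_on A \<phi>"
  by (intro continuous_at_imp_continuous_on ballI differentiable_imp_continuous_within
      test_function_differentiable)

lemma test_function_partial:
  assumes "\<phi> \<in> test_functions" shows "partial i \<phi> \<in> test_functions"
proof -
  have sub: "closure {x. partial i \<phi> x \<noteq> 0} \<subseteq> closure {x. \<phi> x \<noteq> 0}"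
    using partial_eq_0_outside_closure[of _ \<phi> i] by (intro closure_minimal) auto
  have "foldr partial js (partial i \<phi>) differentiable (at x)" for js x
    using assms unfolding test_functions_def smooth_def
    by (auto dest!: spec[of _ "js @ [i]"])
  moreover have "compact (closure {x. partial i \<phi> x \<noteq> 0})"
    using compact_Int_closed[of "closure {x. \<phi> x \<noteq> 0}" "closure {x. partial i \<phi> x \<noteq> 0}"] sub assms
    by (simp add: test_functions_def Int_absorb1)
  ultimately show ?thesis
    using assms sub unfolding test_functions_def smooth_def by blast
qed

lemma test_function_foldr_partial:
  "\<phi> \<in> test_functions \<Longrightarrow> foldr partial is \<phi> \<in> test_functions"
  by (induction "is") (auto intro: test_function_partial)

lemma e_has_derivative:
  "(e k has_derivative (\<lambda>h. 2 * of_real pi * \<i> * of_real (freq k \<bullet> h) * e k x)) (at x)"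
proof -
  have "((\<lambda>x. 2 * of_real pi * \<i> * of_real (freq k \<bullet> x)) has_derivative
      (\<lambda>h. 2 * of_real pi * \<i> * of_real (freq k \<bullet> h))) (at x)"
    by (auto intro!: derivative_eq_intros)
  from has_derivative_compose[OF this DERIV_exp[unfolded has_field_derivative_def]] show ?thesis
    by (simp add: e_def[abs_def] mult.commute)
qed

lemma integral_cube_eq_lborel:
  assumes "continuous_on UNIV g" "\<And>x. x \<notin> cube \<Longrightarrow> g x = 0"
  shows "(LINT x|lebesgue_on cube. g x :: complex) = (LINT x|lborel. g x)"
proof -
  have "(LINT x|lebesgue_on cube. g x) = (LINT x|lebesgue. indicator cube x *\<^sub>R g x)"
    by (subst integral_restrict_space) auto
  also have "\<dots> = (LINT x|lebesgue. g x)"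
    using assms(2) by (intro Bochner_Integration.integral_cong) (auto simp: indicator_def)
  also have "\<dots> = (LINT x|lborel. g x)"
    using borel_measurable_continuous_onI[OF assms(1)] by (intro integral_completion) simp
  finally show ?thesis .
qed

lemma test_function_outside_cube:
  assumes "\<phi> \<in> test_functions" "x \<notin> cube" shows "\<phi> x = 0"
  using assms closure_subset[of "{x. \<phi> x \<noteq> 0}"] by (auto simp: test_functions_def)

lemma integral_e_partial:
  assumes \<phi>: "\<phi> \<in> test_functions"
  shows "(LINT x|lebesgue_on cube. e k x * partial i \<phi> x)
    = - (2 * of_real pi * \<i> * of_int (k $ i)) * (LINT x|lebesgue_on cube. e k x * \<phi> x)"
proof -
  let ?c = "2 * of_real pi * \<i> * of_int (k $ i) :: complex"
  let ?f = "\<lambda>x. e k x * \<phi> x"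
  note p\<phi> = test_function_partial[OF \<phi>, of i]
  have der: "(?f has_derivative (\<lambda>h. e k x * frechet_derivative \<phi> (at x) h
      + 2 * of_real pi * \<i> * of_real (freq k \<bullet> h) * e k x * \<phi> x)) (at x)" for x
    by (intro has_derivative_mult e_has_derivative)
      (use test_function_differentiable[OF \<phi>] frechet_derivative_works in blast)
  have partial_f: "partial i ?f x = ?c * (e k x * \<phi> x) + e k x * partial i \<phi> x" for x
    using partial_eq[OF der, of i x] by (simp add: partial_def freq_def inner_axis mult_ac)
  have "(LINT x|lborel. partial i ?f x) = 0"
  proof (rule integral_partial_eq_0)
    show "?f differentiable (at x)" for x
      using der unfolding differentiable_def by blast
    show "continuous_on UNIV (partial i ?f)"
      unfolding partial_f
      by (intro continuous_intros test_function_continuous \<phi> p\<phi>)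
    have "{x. ?f x \<noteq> 0} = {x. \<phi> x \<noteq> 0}"
      by (auto simp: e_def)
    then show "compact (closure {x. ?f x \<noteq> 0})"
      using \<phi> by (simp add: test_functions_def)
  qed
  moreover have "(LINT x|lebesgue_on cube. partial i ?f x) = (LINT x|lborel. partial i ?f x)"
    unfolding partial_f
    by (intro integral_cube_eq_lborel continuous_intros test_function_continuous \<phi> p\<phi>)
      (simp add: test_function_outside_cube \<phi> p\<phi>)
  moreover have "(LINT x|lebesgue_on cube. partial i ?f x)
      = ?c * (LINT x|lebesgue_on cube. e k x * \<phi> x) + (LINT x|lebesgue_on cube. e k x * partial i \<phi> x)"
    unfolding partial_f
    by (subst Bochner_Integration.integral_add)
      (simp_all add: L2_integrable_mult L2_continuous[OF test_function_continuous] \<phi> p\<phi>)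
  ultimately show ?thesis by (simp add: eq_neg_iff_add_eq_0 add.commute)
qed

text \<open>
  The factor by which the iterated partial derivative along a list of directions multiplies
  the Fourier coefficient with index \<open>k\<close>.
\<close>

definition symbol :: "'n list \<Rightarrow> int ^ 'n \<Rightarrow> complex" where
  "symbol is k = (\<Prod>i\<leftarrow>is. 2 * of_real pi * \<i> * of_int (k $ i))"

lemma integral_e_foldr_partial:
  assumes "\<phi> \<in> test_functions"
  shows "(LINT x|lebesgue_on cube. e k x * foldr partial is \<phi> x)
    = (- 1) ^ length is * symbol is k * (LINT x|lebesgue_on cube. e k x * \<phi> x)"
proof (induction "is")
  case Nil
  then show ?case by (simp add: symbol_def)
next
  case (Cons i "is")
  then show ?case
    by (simp add: integral_e_partial[OF test_function_foldr_partial[OF assms]] symbol_def)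
qed

lemma norm_symbol_le: "norm (symbol is k) \<le> weight (length is) k"
proof (induction "is")
  case Nil
  then show ?case by (simp add: symbol_def weight_def)
next
  case (Cons i "is")
  let ?r = "norm (freq k)"
  have "\<bar>of_int (k $ i)\<bar> \<le> ?r"
    using component_le_norm_cart[of "freq k" i] by (simp add: freq_def)
  then have "norm (2 * of_real pi * \<i> * of_int (k $ i) :: complex) \<le> 2 * pi * ?r"
    by (simp add: norm_mult)
  also have "\<dots> \<le> 1 + (2 * pi * ?r)\<^sup>2"
  proof -
    have "0 \<le> 2 * pi * ?r" by simp
    moreover have "2 * (2 * pi * ?r) \<le> 1 + (2 * pi * ?r)\<^sup>2"
      using sum_squares_bound[of 1 "2 * pi * ?r"] by simp
    ultimately show ?thesis by linarith
  qed
  finally have "norm (2 * of_real pi * \<i> * of_int (k $ i) :: complex) \<le> 1 + 4 * pi\<^sup>2 * ?r\<^sup>2"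
    by (simp add: power_mult_distrib)
  with Cons.IH show ?case
    by (simp add: symbol_def weight_def norm_mult[of "_ * _"] mult_mono)
qed

lemma weight_ge_1: "weight m k \<ge> 1"
  unfolding weight_def by (rule one_le_power) simp

lemma weight_mono: "l \<le> m \<Longrightarrow> weight l k \<le> weight m k"
  unfolding weight_def by (rule power_increasing) simp_all

text \<open>It follows that the choice in the definition of \<open>D\<close> selects a list with the required counts.\<close>

lemma ex_list_with_counts:
  fixes \<alpha> :: "'n::finite \<Rightarrow> nat"
  shows "\<exists>is. \<forall>i. count_list is i = \<alpha> i"
proof -
  obtain "is" where "mset is = Abs_multiset \<alpha>" using ex_mset by blast
  then have "count (mset is) = \<alpha>" by (simp add: Abs_multiset_inverse)
  then show ?thesis by (metis count_mset)
qed

text \<open>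
  Decay of the Fourier coefficients implies weak differentiability: the weak derivatives are
  the sums of the termwise differentiated Fourier series. The hypothesis asks for
  more decay than finiteness of \<open>hm_norm m U\<close>, namely for the decay that corresponds to order
  \<open>2 * m\<close>; a bound of the symbol by the full weight, rather than by its square root, then
  suffices.
\<close>

lemma sobolevI:
  fixes U :: "real ^ 'n \<Rightarrow> complex"
  assumes U: "U \<in> L2"
    and summable: "(\<lambda>k. (weight m k * norm (fcoef U k))\<^sup>2) summable_on UNIV"
  shows "U \<in> sobolev m"
proof -
  have "\<exists>W\<in>L2. weak_derivative \<alpha> U W" if "order \<alpha> \<le> m" for \<alpha>
  proof -
    \<comment> \<open>the list of directions that the definition of \<open>D \<alpha>\<close> selects\<close>
    define ds where "ds = (SOME is. \<forall>i. count_list is i = \<alpha> i)"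
    have "\<forall>i. count_list ds i = \<alpha> i"
      unfolding ds_def by (rule someI_ex) (rule ex_list_with_counts)
    then have len: "length ds = order \<alpha>"
      using sum_count_set[of ds UNIV] by (simp add: order_def)
    have D_eq: "D \<alpha> \<phi> = foldr partial ds \<phi>" for \<phi> :: "real ^ 'n \<Rightarrow> complex"
      by (simp add: D_def ds_def)
    have "norm (symbol ds k) \<le> weight m k" for k
      using norm_symbol_le weight_mono[of "length ds" m k] len that by (metis order_trans)
    then have "(\<lambda>k. (norm (symbol ds k * fcoef U k))\<^sup>2) summable_on UNIV"
      by (intro summable_on_comparison_test[OF summable])
        (auto simp: norm_mult intro!: power_mono mult_right_mono)
    then obtain W where W: "L2_has_sum (\<lambda>k x. (symbol ds k * fcoef U k) * e k x) W"
      by (rule Riesz_Fischer)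
    have "weak_derivative \<alpha> U W"
      unfolding weak_derivative_def
    proof
      fix \<phi> :: "real ^ 'n \<Rightarrow> complex" assume \<phi>: "\<phi> \<in> test_functions"
      have L2: "(\<lambda>x. cnj (D \<alpha> \<phi> x)) \<in> L2" "(\<lambda>x. cnj (\<phi> x)) \<in> L2"
        unfolding D_eq using test_function_foldr_partial[OF \<phi>]
        by (intro L2_cnj L2_continuous test_function_continuous \<phi>; simp)+
      have "((\<lambda>k. L2_inner (\<lambda>x. fcoef U k * e k x) (\<lambda>x. cnj (D \<alpha> \<phi> x)))
          has_sum L2_inner U (\<lambda>x. cnj (D \<alpha> \<phi> x))) UNIV"
        by (rule L2_has_sum_imp_inner_has_sum[OF Fourier_series_L2[OF U] L2(1)])
      moreover have "((\<lambda>k. (- 1) ^ order \<alpha> * L2_inner (\<lambda>x. (symbol ds k * fcoef U k) * e k x) (\<lambda>x. cnj (\<phi> x)))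
          has_sum (- 1) ^ order \<alpha> * L2_inner W (\<lambda>x. cnj (\<phi> x))) UNIV"
        by (rule has_sum_cmult_right[OF L2_has_sum_imp_inner_has_sum[OF W L2(2)]])
      moreover have "L2_inner (\<lambda>x. fcoef U k * e k x) (\<lambda>x. cnj (D \<alpha> \<phi> x))
          = (- 1) ^ order \<alpha> * L2_inner (\<lambda>x. (symbol ds k * fcoef U k) * e k x) (\<lambda>x. cnj (\<phi> x))" for k
        unfolding L2_inner_cmult_left
        by (simp add: L2_inner_def D_eq integral_e_foldr_partial[OF \<phi>] len)
      ultimately have "L2_inner U (\<lambda>x. cnj (D \<alpha> \<phi> x)) = (- 1) ^ order \<alpha> * L2_inner W (\<lambda>x. cnj (\<phi> x))"
        by (simp only: has_sum_unique)
      then show "(LINT x|lebesgue_on cube. U x * D \<alpha> \<phi> x)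
          = (- 1) ^ order \<alpha> * (LINT x|lebesgue_on cube. W x * \<phi> x)"
        by (simp add: L2_inner_def)
    qed
    with W show ?thesis by (auto simp: L2_has_sum_def)
  qed
  with U show ?thesis by (simp add: sobolev_def)
qed

section \<open>The adjoint of the embedding\<close>

lemma hm_normI: "(\<lambda>k. weight m k * (norm (fcoef u k))\<^sup>2) summable_on UNIV \<Longrightarrow> hm_norm m u < \<infinity>"
  by (simp add: hm_norm_def)

lemma e_in_sobolev: "e k \<in> {u \<in> sobolev m. hm_norm m u < \<infinity>}"
proof -
  have "(\<lambda>j. (weight m j * norm (fcoef (e k) j))\<^sup>2) summable_on UNIV"
    by (rule finite_nonzero_values_imp_summable_on, rule finite_subset[of _ "{k}"]) (auto simp: fcoef_e)
  moreover have "(\<lambda>j. weight m j * (norm (fcoef (e k) j))\<^sup>2) summable_on UNIV"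
    by (rule finite_nonzero_values_imp_summable_on, rule finite_subset[of _ "{k}"]) (auto simp: fcoef_e)
  ultimately show ?thesis by (simp add: sobolevI hm_normI del: ereal_infty_less)
qed

lemma hm_inner_e: "hm_inner m u (e k) = of_real (weight m k) * fcoef u k"
proof -
  have "((\<lambda>j. of_real (weight m j) * fcoef u j * cnj (fcoef (e k) j)) has_sum
      of_real (weight m k) * fcoef u k) UNIV"
    using has_sum_finite_neutralI[of "{k}" UNIV "\<lambda>j. of_real (weight m j) * fcoef u j * cnj (fcoef (e k) j)"
        "of_real (weight m k) * fcoef u k"]
    by (auto simp: fcoef_e)
  then show ?thesis unfolding hm_inner_def by (rule infsumI)
qed

text \<open>
  Dividing the Fourier coefficients of \<open>u\<close> by the weight yields a function \<open>w\<close> that belongs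
  to the Sobolev space, has finite norm, and represents the functional given by \<open>u\<close>: the weight
  cancels, and what remains is Parseval's identity. The pairing converges for every
  square-integrable \<open>v\<close>, whatever the decay of the coefficients of \<open>v\<close>.
\<close>

lemma embedding_adjoint_witness:
  fixes u :: "real ^ 'n \<Rightarrow> complex"
  assumes u: "u \<in> L2"
  obtains w where "w \<in> sobolev m" "hm_norm m w < \<infinity>"
    "\<And>v. v \<in> L2 \<Longrightarrow> ((\<lambda>k. of_real (weight m k) * fcoef w k * cnj (fcoef v k)) has_sum L2_inner u v) UNIV"
proof -
  have pos: "weight m k > 0" for k :: "int ^ 'n" using weight_ge_1[of m k] by linarith
  let ?c = "\<lambda>k. of_real (inverse (weight m k)) * fcoef u k"
  have "(norm (?c k))\<^sup>2 \<le> (norm (fcoef u k))\<^sup>2" for k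
    using weight_ge_1[of m k] pos[of k]
    by (intro power_mono) (auto simp: norm_mult mult_left_le_one_le inverse_le_1_iff norm_inverse)
  then have "(\<lambda>k. (norm (?c k))\<^sup>2) summable_on UNIV"
    by (intro summable_on_comparison_test[OF fcoef_square_summable[OF u]]) auto
  then obtain w where w: "L2_has_sum (\<lambda>k x. ?c k * e k x) w"
    by (rule Riesz_Fischer)
  have coef: "fcoef w k = ?c k" for k by (rule fcoef_L2_has_sum[OF w])
  have coef': "of_real (weight m k) * fcoef w k = fcoef u k" for k
    using pos[of k] by (simp add: coef)
  have norm': "weight m k * norm (fcoef w k) = norm (fcoef u k)" for k
    using arg_cong[OF coef'[of k], of norm] pos[of k] by (simp add: norm_mult)
  have le: "norm (fcoef w k) \<le> norm (fcoef u k)" for k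
    using mult_right_mono[OF weight_ge_1[of m k], of "norm (fcoef w k)"] norm'[of k] by simp
  have "w \<in> sobolev m"
    using w by (intro sobolevI) (simp_all add: norm' fcoef_square_summable[OF u] L2_has_sum_def)
  moreover have "(\<lambda>k. weight m k * (norm (fcoef w k))\<^sup>2) summable_on UNIV"
  proof (rule summable_on_comparison_test[OF fcoef_square_summable[OF u]])
    fix k :: "int ^ 'n"
    have "weight m k * (norm (fcoef w k))\<^sup>2 = norm (fcoef u k) * norm (fcoef w k)"
      by (simp add: power2_eq_square norm' flip: mult.assoc)
    also have "\<dots> \<le> (norm (fcoef u k))\<^sup>2"
      using le[of k] by (simp add: power2_eq_square mult_left_mono)
    finally show "weight m k * (norm (fcoef w k))\<^sup>2 \<le> (norm (fcoef u k))\<^sup>2" .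
    show "0 \<le> weight m k * (norm (fcoef w k))\<^sup>2" using pos[of k] by simp
  qed
  then have "hm_norm m w < \<infinity>" by (rule hm_normI)
  moreover have "((\<lambda>k. of_real (weight m k) * fcoef w k * cnj (fcoef v k)) has_sum L2_inner u v) UNIV"
    if "v \<in> L2" for v
    unfolding coef' by (rule Parseval[OF u that])
  ultimately show ?thesis by (rule that)
qed

theorem proposition7p2:
  fixes m :: nat and H :: "(real ^ 'n \<Rightarrow> complex) set"
  assumes "H = sobolev m \<or> H = {u \<in> sobolev m. hm_norm m u < \<infinity>}"
  shows "(\<exists>A. is_embedding_adjoint m H A) \<and>
         (\<forall>A. is_embedding_adjoint m H A \<longrightarrow>
            (\<forall>u\<in>L2. L2_has_sum
               (\<lambda>(k :: int ^ 'n) x. of_real (inverse (weight m k)) * fcoef u k * e k x) (A u)))"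
proof (intro conjI allI impI ballI)
  have H_L2: "v \<in> L2" if "v \<in> H" for v
    using that assms by (auto simp: sobolev_def)
  have "\<exists>w. w \<in> H \<and> (\<forall>v\<in>H. hm_inner_defined m w v \<and> hm_inner m w v = L2_inner u v)"
    if u: "u \<in> L2" for u
  proof -
    obtain w where w: "w \<in> sobolev m" "hm_norm m w < \<infinity>"
      "\<And>v. v \<in> L2 \<Longrightarrow> ((\<lambda>k. of_real (weight m k) * fcoef w k * cnj (fcoef v k)) has_sum L2_inner u v) UNIV"
      by (rule embedding_adjoint_witness[OF u, of m]) (rule that)
    have "w \<in> H" using w(1,2) assms by auto
    moreover have "hm_inner_defined m w v \<and> hm_inner m w v = L2_inner u v" if "v \<in> H" for v
      using w(3)[OF H_L2[OF that]] unfolding hm_inner_defined_def hm_inner_def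
      by (auto simp: summable_on_def infsumI)
    ultimately show ?thesis by blast
  qed
  then have "\<exists>A. \<forall>u\<in>L2. A u \<in> H \<and> (\<forall>v\<in>H. hm_inner_defined m (A u) v \<and> hm_inner m (A u) v = L2_inner u v)"
    by (intro bchoice ballI)
  then show "\<exists>A. is_embedding_adjoint m H A"
    unfolding is_embedding_adjoint_def .
next
  fix A and u :: "real ^ 'n \<Rightarrow> complex"
  assume A: "is_embedding_adjoint m H A" and u: "u \<in> L2"
  have "A u \<in> H" using A u by (simp add: is_embedding_adjoint_def)
  then have Au: "A u \<in> L2" using assms by (auto simp: sobolev_def)
  have "fcoef (A u) k = of_real (inverse (weight m k)) * fcoef u k" for k
  proof -
    \<comment> \<open>testing the defining identity with \<open>e k\<close> isolates one coefficient\<close>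
    have "e k \<in> H" using assms e_in_sobolev[of k m] by auto
    then have "hm_inner m (A u) (e k) = L2_inner u (e k)"
      using A u by (simp add: is_embedding_adjoint_def)
    then have "of_real (weight m k) * fcoef (A u) k = fcoef u k"
      by (simp add: hm_inner_e fcoef_def)
    then show ?thesis using weight_ge_1[of m k] by (auto simp: field_simps)
  qed
  then show "L2_has_sum (\<lambda>(k :: int ^ 'n) x. of_real (inverse (weight m k)) * fcoef u k * e k x) (A u)"
    using Fourier_series_L2[OF Au] by simp
qed

end
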